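(* Let $(\mathcal{S}_X,\mathcal{S}_Y,\Lambda)$ be a Langland-Poisson triple with $(\mathbf r,\mathbf z)$-cluster pattern $\mathcal{S}_X=\{(\mathbf{x}_t,\tilde B_t)\}_{t\in\mathbb{T}_n}$, $(\mathbf r,\mathbf z)$-cluster algebra $\mathcal{A}$ and upper $(\mathbf r,\mathbf z)$-cluster algebra $\mathcal{U}$. Let $u$ be a good element in $\mathcal{U}$ and let $\mathbf{x}_t$ be an $(\mathbf{r},\mathbf{z})$-cluster of $\mathcal{A}$. Then: (1) If $(x_{k;t}\parallel u)_F=0$ for some $k\in[1,n]$, then the $k$th component $g_{k;t}$ of $\mathbf g_t=\deg^t(u)$ is non-negative. (2) If $(x_{i;t}\parallel u)_F=0$ for any $i\in[1,n]$ (that is, for all such $i$), then $u$ is a cluster monomial in $\mathbf x_t$. (3) Let $k\in[1,n]$ and $(\mathbf x_{t'},\tilde B_{t'})=\mu_k(\mathbf x_t,\tilde B_t)$. Suppose that $(x_{k;t}\parallel u)_F\neq0$ and $(x_{i;t}\parallel u)_F=0$ for all $i\in[1,n]$ with $i\ne k$. Then $u$ is a cluster monomial in $\mathbf x_{t'}$.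
   Context: Notation. $m\ge n\ge1$ are integers, $[1,n]=\{1,\dots,n\}$, $\mathbf r=(r_1,\dots,r_n)$ positive integers, $[a]_+=\max(a,0)$, $\mathbb N=\{0,1,2,\dots\}$. $\mathbf z=(z_{i,s})_{1\le i\le n,1\le s\le r_i-1}$ are formal variables with $z_{i,s}=z_{i,r_i-s}$; $z_{i,0}=z_{i,r_i}=1$. $\mathcal F=\mathbb Q(\mathbf z,x_1,\dots,x_m)$. $\mathbb{P}$ is the multiplicative group of Laurent monomials in $x_{n+1},\dots,x_m$ and $\mathbf z$, and $\mathbb{ZP}$ its group ring. Pattern. $\mathbb T_n$ is the $n$-regular tree with edges labeled by $[1,n]$, the $n$ edges at each vertex having distinct labels; vertices joined by an edge labeled $k$ are $k$-adjacent. $\mathcal S_X$ assigns to each $t\in\mathbb T_n$ a seed: $\mathbf x_t=(x_{1;t},\dots,x_{m;t})$ (a cluster), an $m$-tuple in $\mathcal F$ algebraically independent over $\mathbb Q(\mathbf z)$, and an $m\times n$ integer matrix $\tilde B_t=(b_{ij;t})$ with skew-symmetrizable principal part (first $n$ rows); at a root vertex $t_0$, $\mathbf x_{t_0}=(x_1,\dots,x_m)$. For $k$-adjacent $t,t'$ one has $(\mathbf x_{t'},\tilde B_{t'})=\mu_k(\mathbf x_t,\tilde B_t)$, meaning: $x_{i;t'}=x_{i;t}$ for $i\ne k$, $x_{k;t'}=x_{k;t}^{-1}\bigl(\prod_{j=1}^m x_{j;t}^{[-\varepsilon b_{jk;t}]_+}\bigr)^{r_k}\sum_{s=0}^{r_k}z_{k,s}\hat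 y_{k;t}^{\varepsilon s}$ with $\hat y_{k;t}=\prod_{j=1}^m x_{j;t}^{b_{jk;t}}$; $b_{ij;t'}=-b_{ij;t}$ if $i=k$ or $j=k$, and $b_{ij;t'}=b_{ij;t}+r_k([-\varepsilon b_{ik;t}]_+b_{kj;t}+b_{ik;t}[\varepsilon b_{kj;t}]_+)$ otherwise (independent of $\varepsilon\in\{\pm1\}$). $\mathcal A$ is the $\mathbb{ZP}$-subalgebra of $\mathcal F$ generated by all $x_{i;t}$, $i\in[1,n]$, $t\in\mathbb{T}_n$, and $\mathcal U=\bigcap_{t}\mathbb{ZP}[x_{1;t}^{\pm1},\dots,x_{m;t}^{\pm1}]$. A cluster monomial in $\mathbf x_t$ is an element $\mathbf x_t^{\mathbf h}=\prod_{j=1}^m x_{j;t}^{h_j}$ with $\mathbf h=(h_1,\dots,h_m)\in\mathbb N^m$. Langland-Poisson triple. $\Lambda=\{\Lambda_t\}$ consists of skew-symmetric integer $m\times m$ matrices with $\tilde B_t^\top\Lambda_t=[D\mid 0]$ (an $n\times m$ matrix), $D=\operatorname{diag}(d_1,\dots,d_n)$ with positive integers $d_i$ (so $\tilde B_t$ has rank $n$), and $\Lambda_{t'}=E^\top\Lambda_tE$ for $k$-adjacent $t,t'$, where $E$ differs from $I_m$ only in column $k$, with $E_{kk}=-1$ and $E_{ik}=[-\varepsilon b_{ik;t}r_k]_+$ for $i\ne k$ (independent of $\varepsilon$). $\mathcal S_Y$ is the Langlands dual $Y$-pattern, with $n\times m$ exchange matrices $\hat B_t=(\hat b_{ij;t})=-\tilde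 B_t^\top$. A tropical point in $\mathcal S_Y(\mathbb Z^{\max})$ is a family $\{\mathbf g_t=(g_{1;t},\dots,g_{m;t})^\top\in\mathbb Z^m\mid t\in\mathbb T_n\}$ such that for $k$-adjacent $t,t'$: $g_{k;t'}=-g_{k;t}$ and $g_{i;t'}=g_{i;t}+[r_k\hat b_{ki;t}]_+g_{k;t}-r_k\hat b_{ki;t}[g_{k;t}]_+$ for $i\ne k$. Pointed and good elements. For $\mathbf g,\mathbf g'\in\mathbb Z^m$ write $\mathbf g'\le_t\mathbf g$ if $\mathbf g'=\mathbf g+\tilde B_t\nu$ for some $\nu\in\mathbb N^n$. An element $u\in\mathcal U$ is pointed at $t$ if $u=\sum_{\mathbf h}b_{\mathbf h}\mathbf x_t^{\mathbf h}$ with $b_{\mathbf h}\in\mathbb Z[\mathbf z]$, the set $\{\mathbf h: b_{\mathbf h}\neq0\}$ has a unique maximal element $\mathbf g$ under $\le_t$, and $b_{\mathbf g}=1$; then $\deg^t(u):=\mathbf g$ and $u=\mathbf x_t^{\mathbf g}F_t(\hat y_{1;t},\dots,\hat y_{n;t})$ with $F_t\in\mathbb Z[\mathbf z][\hat y_{1;t},\dots,\hat y_{n;t}]$ of constant term $1$. $u$ is good if it is pointed at every $t$, $\{\deg^t(u)\}_{t}$ is a tropical point in $\mathcal S_Y(\mathbb Z^{\max})$, and for every $t$ it has a subtraction-free rational expression in $\mathbf x_t$ (and $\mathbf z$). Cluster variables are good. $F$-invariant. For a nonzero rational function $F=\bigl(\sum_{\nu\in\mathbb N^n}c_\nu\hat{\mathbf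 y}^\nu\bigr)/\bigl(\sum_{\mu\in\mathbb N^n}d_\mu\hat{\mathbf y}^\mu\bigr)$ with $c_\nu,d_\mu\in\mathbb Z_{\ge0}[\mathbf z]$ (finitely many nonzero), $c_0=d_0=1$, and $\mathbf h\in\mathbb Z^n$, put $F[\mathbf h]=\max\{\nu^\top\mathbf h\mid c_\nu\ne0\}-\max\{\mu^\top\mathbf h\mid d_\mu\neq0\}$ (independent of the chosen expression); for good elements $F_t$ is regarded as such a subtraction-free quotient. For good elements $u=\mathbf x_t^{\mathbf g_t}F_t$, $u'=\mathbf x_t^{\mathbf g'_t}F'_t$ put $\langle u\parallel u'\rangle_t=\mathbf g_t^\top\Lambda_t\mathbf g'_t+F_t[[D\mid0]\mathbf g'_t]$, which is independent of $t\in\mathbb{T}_n$. The $F$-invariant is $(u\parallel u')_F=\langle u\parallel u'\rangle_t+\langle u'\parallel u\rangle_t=F_t[[D\mid0]\mathbf g'_t]+F'_t[[D\mid0]\mathbf g_t]$, for any $t$.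
   Formalization: In (2), (3), u is shown to be a cluster monomial times a Laurent monomial in the frozen variables, and literally a cluster monomial if the frozen components of its degree are non-negative (always if m=n); as stated it fails for m>n, e.g. u the inverse of a frozen variable. *)

theory Defs
  imports Complex_Main "HOL-Library.Poly_Mapping" "Jordan_Normal_Form.Matrix"
begin

text \<open>
  Indices are shifted by one: \<open>{..<n}\<close> and \<open>{..<m}\<close> stand for \<open>[1,n]\<close> and \<open>[1,m]\<close>, so that the
  exchangeable positions are those below \<open>n\<close> and the frozen ones those in \<open>{n..<m}\<close>.
\<close>

section \<open>Polynomials and generated substructures of a field\<close>

definition poly_eval :: "('i \<Rightarrow> 'a::field) \<Rightarrow> (('i \<Rightarrow>\<^sub>0 nat) \<Rightarrow>\<^sub>0 'a) \<Rightarrow> 'a" where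
  "poly_eval f p = (\<Sum>\<nu>\<in>Poly_Mapping.keys p. Poly_Mapping.lookup p \<nu> * (\<Prod>i\<in>Poly_Mapping.keys \<nu>. f i ^ Poly_Mapping.lookup \<nu> i))"

definition poly_over :: "'a::zero set \<Rightarrow> 'i set \<Rightarrow> (('i \<Rightarrow>\<^sub>0 nat) \<Rightarrow>\<^sub>0 'a) \<Rightarrow> bool" where
  "poly_over C I p \<longleftrightarrow> (\<forall>\<nu>. Poly_Mapping.lookup p \<nu> \<in> C) \<and> (\<forall>\<nu>\<in>Poly_Mapping.keys p. Poly_Mapping.keys \<nu> \<subseteq> I)"

definition alg_indep :: "'a::field set \<Rightarrow> 'i set \<Rightarrow> ('i \<Rightarrow> 'a) \<Rightarrow> bool" where
  "alg_indep K I f \<longleftrightarrow> (\<forall>p. poly_over K I p \<and> poly_eval f p = 0 \<longrightarrow> p = 0)"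

definition is_subsemiring :: "'a::field set \<Rightarrow> bool" where
  "is_subsemiring A \<longleftrightarrow> 0 \<in> A \<and> 1 \<in> A \<and> (\<forall>a\<in>A. \<forall>b\<in>A. a + b \<in> A \<and> a * b \<in> A)"

definition is_subring :: "'a::field set \<Rightarrow> bool" where
  "is_subring A \<longleftrightarrow> is_subsemiring A \<and> (\<forall>a\<in>A. - a \<in> A)"

definition is_subfield :: "'a::field set \<Rightarrow> bool" where
  "is_subfield A \<longleftrightarrow> is_subring A \<and> (\<forall>a\<in>A. inverse a \<in> A)"

definition closed_subtraction_free :: "'a::field set \<Rightarrow> bool" where
  "closed_subtraction_free A \<longleftrightarrow> (\<forall>a\<in>A. \<forall>b\<in>A. a + b \<in> A \<and> a * b \<in> A \<and> a / b \<in> A)"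

definition pos_part :: "int \<Rightarrow> int" where
  "pos_part a = max a 0"

section \<open>The regular tree\<close>

text \<open>
  The \<open>n\<close>-regular edge-labelled tree is realised by the words over \<open>{..<n}\<close> without two equal
  consecutive letters; the edges labelled \<open>k\<close> prepend or remove the letter \<open>k\<close>.  The root is the
  empty word; all vertices of the tree are alike, so this is no restriction.
\<close>

definition tree_vertices :: "nat \<Rightarrow> nat list set" where
  "tree_vertices n = {t. set t \<subseteq> {..<n} \<and> distinct_adj t}"

definition tree_adj :: "nat \<Rightarrow> nat \<Rightarrow> nat list \<Rightarrow> nat list \<Rightarrow> bool" where
  "tree_adj n k t t' \<longleftrightarrow> t \<in> tree_vertices n \<and> t' \<in> tree_vertices n \<and> (t' = k # t \<or> t = k # t')"

section \<open>Cluster patterns\<close>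

text \<open>
  The data of a Langland-Poisson triple: the numbers \<open>n\<close> and \<open>m\<close>, the tuple \<open>r\<close>, the variables
  \<open>z\<^sub>i\<^sub>,\<^sub>s\<close>, the clusters, the extended exchange matrices, the diagonal of \<open>D\<close> and the matrices
  \<open>\<Lambda>\<^sub>t\<close>.  The field \<open>\<F>\<close> is the type \<open>'a\<close>.
\<close>

record 'a lp_triple =
  n_mut :: nat
  n_var :: nat
  rdeg :: "nat \<Rightarrow> nat"
  zvar :: "nat \<Rightarrow> nat \<Rightarrow> 'a"
  clus :: "nat list \<Rightarrow> nat \<Rightarrow> 'a"
  exmat :: "nat list \<Rightarrow> int mat"
  ddiag :: "nat \<Rightarrow> int"
  lam :: "nat list \<Rightarrow> int mat"

abbreviation verts :: "'a lp_triple \<Rightarrow> nat list set" where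
  "verts S \<equiv> tree_vertices (n_mut S)"

definition laurent_monomial :: "nat \<Rightarrow> (nat \<Rightarrow> 'a::field) \<Rightarrow> int vec \<Rightarrow> 'a" where
  "laurent_monomial m x h = (\<Prod>j<m. x j powi (h $ j))"

definition z_set :: "'a lp_triple \<Rightarrow> 'a set" where
  "z_set S = {zvar S i s | i s. i < n_mut S \<and> 1 \<le> s \<and> s < rdeg S i}"

definition ring_Zz :: "'a::field lp_triple \<Rightarrow> 'a set" where
  "ring_Zz S = is_subring hull z_set S"

definition semiring_Nz :: "'a::field lp_triple \<Rightarrow> 'a set" where
  "semiring_Nz S = is_subsemiring hull z_set S"

definition field_Qz :: "'a::field lp_triple \<Rightarrow> 'a set" where
  "field_Qz S = is_subfield hull z_set S"

text \<open>
  \<open>z\<^sub>i\<^sub>,\<^sub>s\<close> and \<open>z\<^sub>i\<^sub>,\<^sub>r\<^sub>-\<^sub>s\<close> are the same variable, so the indices with \<open>2 * s \<le> r i\<close> enumerate the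
  distinct variables.
\<close>

definition var_index :: "'a lp_triple \<Rightarrow> (nat \<times> nat + nat) set" where
  "var_index S = {Inl (i, s) | i s. i < n_mut S \<and> 1 \<le> s \<and> s < rdeg S i \<and> 2 * s \<le> rdeg S i}
     \<union> Inr ` {..<n_var S}"

definition var_family :: "'a lp_triple \<Rightarrow> nat \<times> nat + nat \<Rightarrow> 'a" where
  "var_family S v = (case v of Inl (i, s) \<Rightarrow> zvar S i s | Inr j \<Rightarrow> clus S [] j)"

definition ambient_field :: "'a::field_char_0 lp_triple \<Rightarrow> bool" where
  "ambient_field S \<longleftrightarrow>
     (\<forall>i<n_mut S. zvar S i 0 = 1 \<and> zvar S i (rdeg S i) = 1 \<and>
        (\<forall>s\<le>rdeg S i. zvar S i s = zvar S i (rdeg S i - s))) \<and>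
     alg_indep \<rat> (var_index S) (var_family S) \<and>
     is_subfield hull (var_family S ` var_index S) = UNIV"

definition yhat :: "'a::field lp_triple \<Rightarrow> nat list \<Rightarrow> nat \<Rightarrow> 'a" where
  "yhat S t k = laurent_monomial (n_var S) (clus S t) (col (exmat S t) k)"

definition mutated_var :: "'a::field lp_triple \<Rightarrow> int \<Rightarrow> nat \<Rightarrow> nat list \<Rightarrow> nat \<Rightarrow> 'a" where
  "mutated_var S \<epsilon> k t i =
     (if i = k
      then inverse (clus S t k)
        * (\<Prod>j<n_var S. clus S t j powi pos_part (- \<epsilon> * exmat S t $$ (j, k))) ^ rdeg S k
        * (\<Sum>s\<le>rdeg S k. zvar S k s * yhat S t k powi (\<epsilon> * int s))
      else clus S t i)"

definition mutated_mat :: "'a lp_triple \<Rightarrow> int \<Rightarrow> nat \<Rightarrow> nat list \<Rightarrow> int mat" where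
  "mutated_mat S \<epsilon> k t = (let b = exmat S t in
     mat (n_var S) (n_mut S) (\<lambda>(i, j).
       if i = k \<or> j = k then - b $$ (i, j)
       else b $$ (i, j) + int (rdeg S k) *
         (pos_part (- \<epsilon> * b $$ (i, k)) * b $$ (k, j) + b $$ (i, k) * pos_part (\<epsilon> * b $$ (k, j)))))"

text \<open>The seed at \<open>t'\<close> is the mutation in direction \<open>k\<close> of the seed at \<open>t\<close>.\<close>

definition seed_mutation :: "'a::field lp_triple \<Rightarrow> nat \<Rightarrow> nat list \<Rightarrow> nat list \<Rightarrow> bool" where
  "seed_mutation S k t t' \<longleftrightarrow> (\<forall>\<epsilon>\<in>{1, -1}.
     (\<forall>i<n_var S. clus S t' i = mutated_var S \<epsilon> k t i) \<and> exmat S t' = mutated_mat S \<epsilon> k t)"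

definition skew_symmetrizable_part :: "nat \<Rightarrow> int mat \<Rightarrow> bool" where
  "skew_symmetrizable_part n b \<longleftrightarrow> (\<exists>c :: nat \<Rightarrow> int. (\<forall>i<n. c i > 0) \<and>
     (\<forall>i<n. \<forall>j<n. c i * b $$ (i, j) = - (c j * b $$ (j, i))))"

definition is_seed :: "'a::field lp_triple \<Rightarrow> nat list \<Rightarrow> bool" where
  "is_seed S t \<longleftrightarrow>
     alg_indep (field_Qz S) {..<n_var S} (clus S t) \<and>
     exmat S t \<in> carrier_mat (n_var S) (n_mut S) \<and>
     skew_symmetrizable_part (n_mut S) (exmat S t)"

definition cluster_pattern :: "'a::field_char_0 lp_triple \<Rightarrow> bool" where
  "cluster_pattern S \<longleftrightarrow>
     1 \<le> n_mut S \<and> n_mut S \<le> n_var S \<and> (\<forall>i<n_mut S. 0 < rdeg S i) \<and>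
     ambient_field S \<and>
     (\<forall>t\<in>verts S. is_seed S t) \<and>
     (\<forall>k t t'. tree_adj (n_mut S) k t t' \<longrightarrow> seed_mutation S k t t')"

section \<open>Langland-Poisson triples and tropical points\<close>

definition D0 :: "'a lp_triple \<Rightarrow> int mat" where
  "D0 S = mat (n_mut S) (n_var S) (\<lambda>(i, j). if i = j then ddiag S i else 0)"

definition E_mat :: "'a lp_triple \<Rightarrow> int \<Rightarrow> nat \<Rightarrow> nat list \<Rightarrow> int mat" where
  "E_mat S \<epsilon> k t = mat (n_var S) (n_var S) (\<lambda>(i, j).
     if j = k then (if i = k then -1 else pos_part (- \<epsilon> * exmat S t $$ (i, k) * int (rdeg S k)))
     else if i = j then 1 else 0)"

definition langlands_poisson_triple :: "'a::field_char_0 lp_triple \<Rightarrow> bool" where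
  "langlands_poisson_triple S \<longleftrightarrow>
     cluster_pattern S \<and>
     (\<forall>i<n_mut S. 0 < ddiag S i) \<and>
     (\<forall>t\<in>verts S. lam S t \<in> carrier_mat (n_var S) (n_var S) \<and>
        transpose_mat (lam S t) = - lam S t \<and>
        transpose_mat (exmat S t) * lam S t = D0 S) \<and>
     (\<forall>k t t'. tree_adj (n_mut S) k t t' \<longrightarrow>
        (\<forall>\<epsilon>\<in>{1, -1}. lam S t' = transpose_mat (E_mat S \<epsilon> k t) * lam S t * E_mat S \<epsilon> k t))"

definition dual_exmat :: "'a lp_triple \<Rightarrow> nat list \<Rightarrow> int mat" where
  "dual_exmat S t = - transpose_mat (exmat S t)"

definition tropical_point :: "'a lp_triple \<Rightarrow> (nat list \<Rightarrow> int vec) \<Rightarrow> bool" where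
  "tropical_point S g \<longleftrightarrow>
     (\<forall>t\<in>verts S. g t \<in> carrier_vec (n_var S)) \<and>
     (\<forall>k t t'. tree_adj (n_mut S) k t t' \<longrightarrow>
        g t' $ k = - (g t $ k) \<and>
        (\<forall>i<n_var S. i \<noteq> k \<longrightarrow>
           g t' $ i = g t $ i + pos_part (int (rdeg S k) * dual_exmat S t $$ (k, i)) * g t $ k
             - int (rdeg S k) * dual_exmat S t $$ (k, i) * pos_part (g t $ k)))"

section \<open>Pointed and good elements\<close>

definition ring_ZP :: "'a::field lp_triple \<Rightarrow> 'a set" where
  "ring_ZP S = is_subring hull
     (z_set S \<union> inverse ` z_set S \<union> clus S [] ` {n_mut S..<n_var S}
       \<union> inverse ` clus S [] ` {n_mut S..<n_var S})"

definition laurent_ring :: "'a::field lp_triple \<Rightarrow> nat list \<Rightarrow> 'a set" where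
  "laurent_ring S t = is_subring hull
     (ring_ZP S \<union> clus S t ` {..<n_var S} \<union> inverse ` clus S t ` {..<n_var S})"

definition upper_cluster_algebra :: "'a::field lp_triple \<Rightarrow> 'a set" where
  "upper_cluster_algebra S = (\<Inter>t\<in>verts S. laurent_ring S t)"

definition dom_le :: "'a lp_triple \<Rightarrow> nat list \<Rightarrow> int vec \<Rightarrow> int vec \<Rightarrow> bool" where
  "dom_le S t g' g \<longleftrightarrow> (\<exists>\<nu>\<in>carrier_vec (n_mut S). (\<forall>i<n_mut S. 0 \<le> \<nu> $ i) \<and>
     g' = g + exmat S t *\<^sub>v \<nu>)"

definition dom_maximal :: "'a lp_triple \<Rightarrow> nat list \<Rightarrow> int vec set \<Rightarrow> int vec \<Rightarrow> bool" where
  "dom_maximal S t H g \<longleftrightarrow> g \<in> H \<and> (\<forall>g'\<in>H. dom_le S t g g' \<longrightarrow> g' = g)"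

definition pointed_with :: "'a::field lp_triple \<Rightarrow> nat list \<Rightarrow> 'a \<Rightarrow> int vec \<Rightarrow> bool" where
  "pointed_with S t u g \<longleftrightarrow> u \<in> upper_cluster_algebra S \<and>
     (\<exists>b :: int vec \<Rightarrow>\<^sub>0 'a.
        Poly_Mapping.keys b \<subseteq> carrier_vec (n_var S) \<and> (\<forall>h. Poly_Mapping.lookup b h \<in> ring_Zz S) \<and>
        u = (\<Sum>h\<in>Poly_Mapping.keys b. Poly_Mapping.lookup b h * laurent_monomial (n_var S) (clus S t) h) \<and>
        (\<forall>g'. dom_maximal S t (Poly_Mapping.keys b) g' \<longleftrightarrow> g' = g) \<and>
        Poly_Mapping.lookup b g = 1)"

definition pointed :: "'a::field lp_triple \<Rightarrow> nat list \<Rightarrow> 'a \<Rightarrow> bool" where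
  "pointed S t u \<longleftrightarrow> (\<exists>g. pointed_with S t u g)"

definition deg :: "'a::field lp_triple \<Rightarrow> nat list \<Rightarrow> 'a \<Rightarrow> int vec" where
  "deg S t u = (THE g. pointed_with S t u g)"

definition F_poly :: "'a::field lp_triple \<Rightarrow> nat list \<Rightarrow> 'a \<Rightarrow> (nat \<Rightarrow>\<^sub>0 nat) \<Rightarrow>\<^sub>0 'a" where
  "F_poly S t u = (THE F. poly_over (ring_Zz S) {..<n_mut S} F \<and> Poly_Mapping.lookup F 0 = 1 \<and>
     u = laurent_monomial (n_var S) (clus S t) (deg S t u) * poly_eval (yhat S t) F)"

definition subtraction_free :: "'a::field lp_triple \<Rightarrow> nat list \<Rightarrow> 'a set" where
  "subtraction_free S t = closed_subtraction_free hull (z_set S \<union> clus S t ` {..<n_var S})"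

definition good :: "'a::field lp_triple \<Rightarrow> 'a \<Rightarrow> bool" where
  "good S u \<longleftrightarrow>
     (\<forall>t\<in>verts S. pointed S t u) \<and>
     tropical_point S (\<lambda>t. deg S t u) \<and>
     (\<forall>t\<in>verts S. u \<in> subtraction_free S t)"

section \<open>The F-invariant\<close>

definition max_deg :: "'a lp_triple \<Rightarrow> ((nat \<Rightarrow>\<^sub>0 nat) \<Rightarrow>\<^sub>0 'a::zero) \<Rightarrow> int vec \<Rightarrow> int" where
  "max_deg S p h = Max ((\<lambda>\<nu>. \<Sum>i<n_mut S. int (Poly_Mapping.lookup \<nu> i) * h $ i) ` Poly_Mapping.keys p)"

text \<open>
  \<open>F[h] = c\<close>.  The value is taken from any expression of \<open>F\<close> as a quotient \<open>P / Q\<close> of polynomials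
  with coefficients in \<open>\<nat>[z]\<close> and constant term 1; it is not defined in the absence of such an
  expression, whence a relation.
\<close>

definition has_trop_value ::
    "'a::field lp_triple \<Rightarrow> ((nat \<Rightarrow>\<^sub>0 nat) \<Rightarrow>\<^sub>0 'a) \<Rightarrow> int vec \<Rightarrow> int \<Rightarrow> bool" where
  "has_trop_value S F h c \<longleftrightarrow>
     (\<exists>P Q. poly_over (semiring_Nz S) {..<n_mut S} P \<and> Poly_Mapping.lookup P 0 = 1 \<and>
            poly_over (semiring_Nz S) {..<n_mut S} Q \<and> Poly_Mapping.lookup Q 0 = 1 \<and>
            F * Q = P \<and> c = max_deg S P h - max_deg S Q h)"

definition has_pairing :: "'a::field lp_triple \<Rightarrow> nat list \<Rightarrow> 'a \<Rightarrow> 'a \<Rightarrow> int \<Rightarrow> bool" where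
  "has_pairing S t u u' c \<longleftrightarrow>
     (\<exists>f. has_trop_value S (F_poly S t u) (D0 S *\<^sub>v deg S t u') f \<and>
          c = deg S t u \<bullet> (lam S t *\<^sub>v deg S t u') + f)"

text \<open>
  The F-invariant of \<open>u\<close> and \<open>u'\<close> equals \<open>c\<close>.  It is a partial function, defined for good elements
  only; the value may be computed at any vertex.
\<close>

definition has_F_invariant :: "'a::field lp_triple \<Rightarrow> 'a \<Rightarrow> 'a \<Rightarrow> int \<Rightarrow> bool" where
  "has_F_invariant S u u' c \<longleftrightarrow> good S u \<and> good S u' \<and>
     (\<exists>t\<in>verts S. \<exists>a b. has_pairing S t u u' a \<and> has_pairing S t u' u b \<and> c = a + b)"

section \<open>Cluster monomials\<close>

definition cluster_monomial :: "'a::field lp_triple \<Rightarrow> nat list \<Rightarrow> 'a \<Rightarrow> bool" where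
  "cluster_monomial S t u \<longleftrightarrow> (\<exists>h :: nat \<Rightarrow> nat. u = (\<Prod>j<n_var S. clus S t j ^ h j))"

definition frozen_laurent_monomial :: "'a::field lp_triple \<Rightarrow> 'a \<Rightarrow> bool" where
  "frozen_laurent_monomial S p \<longleftrightarrow>
     (\<exists>h :: nat \<Rightarrow> int. p = (\<Prod>j\<in>{n_mut S..<n_var S}. clus S [] j powi h j))"

text \<open>
  Inverses of frozen variables are themselves good elements, with vanishing F-invariant against
  every good element.  Hence a good element can be recognised as a cluster monomial only up to
  a Laurent monomial in the frozen variables; that factor can be omitted exactly when the frozen
  components of the degree are non-negative, in particular when \<open>m = n\<close>.
\<close>

definition cluster_monomial_mod_frozen :: "'a::field lp_triple \<Rightarrow> nat list \<Rightarrow> 'a \<Rightarrow> bool" where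
  "cluster_monomial_mod_frozen S t u \<longleftrightarrow>
     (\<exists>p w. frozen_laurent_monomial S p \<and> cluster_monomial S t w \<and> u = p * w) \<and>
     ((\<forall>j\<in>{n_mut S..<n_var S}. 0 \<le> deg S t u $ j) \<longrightarrow> cluster_monomial S t u)"

end

theory Submission
  imports Defs
begin

text \<open>
  For a good element \<open>u'\<close> of degree \<open>q\<close> at \<open>t\<close>, the pairing of \<open>u\<close> with \<open>u'\<close> is the value at \<open>u\<close> of
  the tropical valuation that gives the cluster variables at \<open>t\<close> the weights \<open>lam S t *\<^sub>v q\<close>.  These
  weights follow the tropicalised exchange relations when \<open>q\<close> mutates as a tropical point, and on
  subtraction-free elements a tropical valuation is determined by its weights; hence the pairing
  does not depend on \<open>t\<close>.

  Computed at \<open>t\<close>, the F-invariant of \<open>x\<^sub>k\<close> and \<open>u\<close> is \<open>ddiag S k\<close> times the degree of the F-polynomial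
  of \<open>u\<close> in the \<open>k\<close>-th variable.  Comparing the pairings of \<open>u\<close> with the tropical points through
  plus or minus the \<open>k\<close>-th unit vector at both ends of an edge labelled \<open>k\<close> shows that a negative
  \<open>k\<close>-th component of \<open>deg S t u\<close> forces the F-polynomial at \<open>t\<close> to involve the \<open>k\<close>-th variable, and
  that, if the F-polynomials at both ends involve no other variable, one of them is trivial.
\<close>

section \<open>Evaluation and weighted degree on monoid algebras\<close>

definition meval :: "('e \<Rightarrow> 'a) \<Rightarrow> ('e \<Rightarrow>\<^sub>0 'a::comm_semiring_1) \<Rightarrow> 'a" where
  "meval \<phi> P = (\<Sum>e\<in>Poly_Mapping.keys P. Poly_Mapping.lookup P e * \<phi> e)"

lemma meval_superset:
  assumes "finite A" and "Poly_Mapping.keys P \<subseteq> A"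
  shows "meval \<phi> P = (\<Sum>e\<in>A. Poly_Mapping.lookup P e * \<phi> e)"
  unfolding meval_def
  by (rule sum.mono_neutral_left) (use assms in \<open>auto simp: in_keys_iff\<close>)

lemma meval_add: "meval \<phi> (P + Q) = meval \<phi> P + meval \<phi> Q"
proof -
  let ?A = "Poly_Mapping.keys P \<union> Poly_Mapping.keys Q"
  have "Poly_Mapping.keys (P + Q) \<subseteq> ?A" by (rule keys_add)
  then show ?thesis
    by (simp add: meval_superset[where A = ?A] lookup_add distrib_right sum.distrib)
qed

lemma meval_zero [simp]: "meval \<phi> 0 = 0"
  by (simp add: meval_def)

lemma meval_single [simp]: "meval \<phi> (Poly_Mapping.single e c) = c * \<phi> e"
  by (simp add: meval_def)

lemma meval_sum: "meval \<phi> (\<Sum>i\<in>I. P i) = (\<Sum>i\<in>I. meval \<phi> (P i))"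
  by (induction I rule: infinite_finite_induct) (simp_all add: meval_add)

lemma sum_single_keys:
  "P = (\<Sum>e\<in>Poly_Mapping.keys P. Poly_Mapping.single e (Poly_Mapping.lookup P e))"
  by (rule poly_mapping_eqI) (auto simp: lookup_sum lookup_single in_keys_iff when_def)

lemma times_eq_sum_single:
  fixes P Q :: "'e::comm_monoid_add \<Rightarrow>\<^sub>0 'a::comm_semiring_1"
  shows "P * Q = (\<Sum>a\<in>Poly_Mapping.keys P. \<Sum>b\<in>Poly_Mapping.keys Q.
    Poly_Mapping.single (a + b) (Poly_Mapping.lookup P a * Poly_Mapping.lookup Q b))"
proof -
  have "P * Q = (\<Sum>a\<in>Poly_Mapping.keys P. Poly_Mapping.single a (Poly_Mapping.lookup P a)) *
    (\<Sum>b\<in>Poly_Mapping.keys Q. Poly_Mapping.single b (Poly_Mapping.lookup Q b))"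
    using sum_single_keys[of P] sum_single_keys[of Q] by simp
  then show ?thesis
    by (simp add: sum_product mult_single)
qed

lemma meval_mult:
  fixes P Q :: "'e::comm_monoid_add \<Rightarrow>\<^sub>0 'a::comm_semiring_1"
  assumes "\<And>a b. \<phi> (a + b) = \<phi> a * \<phi> b"
  shows "meval \<phi> (P * Q) = meval \<phi> P * meval \<phi> Q"
  by (simp add: times_eq_sum_single meval_sum assms)
    (simp add: meval_def sum_product mult_ac)

definition reindex :: "('e \<Rightarrow> 'f) \<Rightarrow> ('e \<Rightarrow>\<^sub>0 'a::comm_monoid_add) \<Rightarrow> 'f \<Rightarrow>\<^sub>0 'a" where
  "reindex f P = (\<Sum>e\<in>Poly_Mapping.keys P. Poly_Mapping.single (f e) (Poly_Mapping.lookup P e))"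

lemma lookup_reindex:
  assumes "inj_on f A" and "Poly_Mapping.keys P \<subseteq> A" and "e \<in> A"
  shows "Poly_Mapping.lookup (reindex f P) (f e) = Poly_Mapping.lookup P e"
proof -
  have "Poly_Mapping.lookup (reindex f P) (f e) =
      (\<Sum>a\<in>Poly_Mapping.keys P. if a = e then Poly_Mapping.lookup P a else 0)"
    unfolding reindex_def lookup_sum
    by (rule sum.cong) (use assms in \<open>auto simp: lookup_single when_def inj_on_def\<close>)
  then show ?thesis by (auto simp: in_keys_iff)
qed

lemma lookup_reindex_notin:
  "h \<notin> f ` Poly_Mapping.keys P \<Longrightarrow> Poly_Mapping.lookup (reindex f P) h = 0"
  unfolding reindex_def lookup_sum
  by (rule sum.neutral) (auto simp: lookup_single when_def)

lemma keys_reindex: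
  assumes "inj_on f (Poly_Mapping.keys P)"
  shows "Poly_Mapping.keys (reindex f P) = f ` Poly_Mapping.keys P"
  using lookup_reindex[OF assms order_refl] lookup_reindex_notin[of _ f P]
  by (auto simp: in_keys_iff)

lemma lookup_reindex_in:
  assumes "inj_on f (Poly_Mapping.keys P)" and "0 \<in> C" and "\<And>e. Poly_Mapping.lookup P e \<in> C"
  shows "Poly_Mapping.lookup (reindex f P) h \<in> C"
  using lookup_reindex[OF assms(1) order_refl] lookup_reindex_notin[of h f P] assms(2,3)
  by (cases "h \<in> f ` Poly_Mapping.keys P") auto

lemma reindex_inj:
  assumes "inj_on f A" and "Poly_Mapping.keys P \<subseteq> A" and "Poly_Mapping.keys Q \<subseteq> A"
    and "reindex f P = reindex f Q"
  shows "P = Q"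
proof (rule poly_mapping_eqI)
  fix e
  show "Poly_Mapping.lookup P e = Poly_Mapping.lookup Q e"
  proof (cases "e \<in> A")
    case True
    then show ?thesis using lookup_reindex assms by metis
  next
    case False
    then show ?thesis using assms by (metis in_keys_iff subsetD)
  qed
qed

lemma meval_reindex:
  "meval \<phi> (reindex f P) = (\<Sum>e\<in>Poly_Mapping.keys P. Poly_Mapping.lookup P e * \<phi> (f e))"
  by (simp add: reindex_def meval_sum)

definition wmax :: "('e \<Rightarrow> int) \<Rightarrow> ('e \<Rightarrow>\<^sub>0 'a::zero) \<Rightarrow> int" where
  "wmax \<omega> P = Max (\<omega> ` Poly_Mapping.keys P)"

lemma wmax_single [simp]: "c \<noteq> 0 \<Longrightarrow> wmax \<omega> (Poly_Mapping.single e c) = \<omega> e"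
  by (simp add: wmax_def)

lemma single_neq_0: "(c::'b::zero) \<noteq> 0 \<Longrightarrow> Poly_Mapping.single e c \<noteq> 0"
  by (metis lookup_single_eq lookup_zero)

lemma keys_nonempty: "P \<noteq> 0 \<Longrightarrow> Poly_Mapping.keys P \<noteq> {}"
  by (metis poly_mapping_eqI in_keys_iff empty_iff lookup_zero)

lemma wmax_ge: "e \<in> Poly_Mapping.keys P \<Longrightarrow> \<omega> e \<le> wmax \<omega> P"
  by (simp add: wmax_def)

lemma wmax_attained: "P \<noteq> 0 \<Longrightarrow> \<exists>e\<in>Poly_Mapping.keys P. \<omega> e = wmax \<omega> P"
  unfolding wmax_def using Max_in[of "\<omega> ` Poly_Mapping.keys P"] keys_nonempty by fastforce

lemma wmax_eqI:
  assumes "e \<in> Poly_Mapping.keys P" and "\<omega> e = c" and "\<And>e. e \<in> Poly_Mapping.keys P \<Longrightarrow> \<omega> e \<le> c"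
  shows "wmax \<omega> P = c"
  unfolding wmax_def by (rule Max_eqI) (use assms in auto)

text \<open>
  The products of the parts of top weight cannot cancel, because the monoid algebra of an ordered
  monoid over a domain is a domain.
\<close>

lemma wmax_mult:
  fixes P Q :: "'e::{ordered_cancel_comm_monoid_add, linorder} \<Rightarrow>\<^sub>0 'a::idom"
  assumes add: "\<And>a b. \<omega> (a + b) = \<omega> a + \<omega> b" and P: "P \<noteq> 0" and Q: "Q \<noteq> 0"
  shows "wmax \<omega> (P * Q) = wmax \<omega> P + wmax \<omega> Q"
proof -
  define top where "top R = (\<Sum>e\<in>{e\<in>Poly_Mapping.keys R. \<omega> e = wmax \<omega> R}.
    Poly_Mapping.single e (Poly_Mapping.lookup R e))" for R :: "'e \<Rightarrow>\<^sub>0 'a"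
  have lookup_top: "Poly_Mapping.lookup (top R) e = (if \<omega> e = wmax \<omega> R then Poly_Mapping.lookup R e else 0)"
    for R e
    by (auto simp: top_def lookup_sum lookup_single when_def in_keys_iff)
  have top_nz: "top R \<noteq> 0" if "R \<noteq> 0" for R
  proof -
    obtain e where "e \<in> Poly_Mapping.keys R" "\<omega> e = wmax \<omega> R"
      using wmax_attained[OF \<open>R \<noteq> 0\<close>] by auto
    then have "Poly_Mapping.lookup (top R) e \<noteq> 0"
      by (simp add: lookup_top in_keys_iff)
    then show ?thesis by auto
  qed
  have top_keys: "\<omega> e = wmax \<omega> R" if "e \<in> Poly_Mapping.keys (top R)" for e R
    using that by (auto simp: in_keys_iff lookup_top split: if_splits)
  have rest_keys: "\<omega> e < wmax \<omega> R" if "e \<in> Poly_Mapping.keys (R - top R)" for e R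
  proof -
    have "e \<in> Poly_Mapping.keys R" "\<omega> e \<noteq> wmax \<omega> R"
      using that by (auto simp: in_keys_iff lookup_minus lookup_top split: if_splits)
    then show ?thesis using wmax_ge[of e R \<omega>] by simp
  qed
  have "top P * top Q \<noteq> 0" using top_nz P Q by simp
  then obtain \<kappa> where \<kappa>: "\<kappa> \<in> Poly_Mapping.keys (top P * top Q)"
    using keys_nonempty by blast
  then have w\<kappa>: "\<omega> \<kappa> = wmax \<omega> P + wmax \<omega> Q"
    using keys_mult[of "top P" "top Q"] top_keys add by fastforce
  have "\<kappa> \<notin> Poly_Mapping.keys (top P * (Q - top Q))"
    using keys_mult[of "top P" "Q - top Q"] top_keys[of _ P] rest_keys[of _ Q] add w\<kappa> by fastforce
  moreover have "\<kappa> \<notin> Poly_Mapping.keys ((P - top P) * Q)"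
    using keys_mult[of "P - top P" Q] wmax_ge[of _ Q \<omega>] rest_keys[of _ P] add w\<kappa> by fastforce
  moreover have "P * Q = top P * top Q + (top P * (Q - top Q) + (P - top P) * Q)"
    by (simp add: algebra_simps)
  ultimately have "Poly_Mapping.lookup (P * Q) \<kappa> = Poly_Mapping.lookup (top P * top Q) \<kappa>"
    by (simp add: lookup_add in_keys_iff)
  with \<kappa> have "\<kappa> \<in> Poly_Mapping.keys (P * Q)" by (simp add: in_keys_iff)
  then show ?thesis
  proof (rule wmax_eqI)
    show "\<omega> \<kappa> = wmax \<omega> P + wmax \<omega> Q" by (rule w\<kappa>)
    fix e assume "e \<in> Poly_Mapping.keys (P * Q)"
    then obtain a b where "e = a + b" "a \<in> Poly_Mapping.keys P" "b \<in> Poly_Mapping.keys Q"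
      using keys_mult[of P Q] by blast
    then show "\<omega> e \<le> wmax \<omega> P + wmax \<omega> Q"
      using wmax_ge[of a P \<omega>] wmax_ge[of b Q \<omega>] add by simp
  qed
qed

lemma subsemiring_sum:
  assumes "is_subsemiring C" and "\<And>i. i \<in> I \<Longrightarrow> f i \<in> C"
  shows "sum f I \<in> C"
  using assms(2)
  by (induction I rule: infinite_finite_induct)
    (use assms(1) in \<open>auto simp: is_subsemiring_def\<close>)

lemma lookup_mult_in_subsemiring:
  fixes P Q :: "'e::comm_monoid_add \<Rightarrow>\<^sub>0 'a::field"
  assumes "is_subsemiring C"
    and "\<And>e. Poly_Mapping.lookup P e \<in> C" and "\<And>e. Poly_Mapping.lookup Q e \<in> C"
  shows "Poly_Mapping.lookup (P * Q) e \<in> C"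
proof -
  have "(Poly_Mapping.lookup P a * Poly_Mapping.lookup Q b when a + b = e) \<in> C" for a b
    using assms by (auto simp: is_subsemiring_def when_def)
  then show ?thesis
    by (simp add: times_eq_sum_single lookup_sum lookup_single)
      (intro subsemiring_sum assms(1); simp)
qed

lemma poly_eval_var:
  fixes f :: "'i \<Rightarrow> 'a::field"
  shows "poly_eval f (Poly_Mapping.single (Poly_Mapping.single v 1) 1) = f v"
  by (simp add: poly_eval_def)

lemma poly_over_single:
  assumes "0 \<in> C" "c \<in> C" "Poly_Mapping.keys \<nu> \<subseteq> I"
  shows "poly_over C I (Poly_Mapping.single \<nu> c)"
  using assms by (auto simp: poly_over_def lookup_single when_def)

lemma alg_indep_nonzero:
  assumes "is_subsemiring K" and "alg_indep K I f" and "i \<in> I"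
  shows "f i \<noteq> 0"
proof
  let ?p = "Poly_Mapping.single (Poly_Mapping.single i 1) 1 :: ('b \<Rightarrow>\<^sub>0 nat) \<Rightarrow>\<^sub>0 'a"
  assume "f i = 0"
  then have "poly_eval f ?p = 0" by (simp only: poly_eval_var)
  moreover have "poly_over K I ?p"
    by (rule poly_over_single) (use assms in \<open>auto simp: is_subsemiring_def\<close>)
  ultimately have "?p = 0" using assms(2) unfolding alg_indep_def by blast
  then show False by (simp add: single_neq_0)
qed

section \<open>Tropical valuations in a Laurent chart\<close>

definition expo :: "nat \<Rightarrow> int vec \<Rightarrow> nat \<Rightarrow>\<^sub>0 int" where
  "expo m v = Abs_poly_mapping (\<lambda>j. if j < m then v $ j else 0)"

lemma lookup_expo [simp]: "Poly_Mapping.lookup (expo m v) j = (if j < m then v $ j else 0)"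
proof -
  have "finite {j. (if j < m then v $ j else 0) \<noteq> 0}"
    by (rule finite_subset[of _ "{..<m}"]) auto
  then show ?thesis by (simp add: expo_def)
qed

lemma keys_expo: "Poly_Mapping.keys (expo m v) \<subseteq> {..<m}"
  by (auto simp: in_keys_iff split: if_splits)

lemma inj_on_expo: "inj_on (expo m) (carrier_vec m)"
proof (rule inj_onI)
  fix v w :: "int vec" assume vw: "v \<in> carrier_vec m" "w \<in> carrier_vec m" "expo m v = expo m w"
  have "v $ j = w $ j" if "j < m" for j
    using arg_cong[OF vw(3), of "\<lambda>p. Poly_Mapping.lookup p j"] that by simp
  then show "v = w" using vw by auto
qed

locale laurent_chart =
  fixes m :: nat and x :: "nat \<Rightarrow> 'a::field_char_0" and K N :: "'a set"
  assumes K: "is_subfield K" and indep: "alg_indep K {..<m} x"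
    and N: "is_subsemiring N" and N_K: "N \<subseteq> K"
    and N_cone: "\<lbrakk>a \<in> N; b \<in> N; a + b = 0\<rbrakk> \<Longrightarrow> a = 0"
begin

lemma K_semiring: "is_subsemiring K"
  using K by (simp add: is_subfield_def is_subring_def)

lemma x_nonzero: "j < m \<Longrightarrow> x j \<noteq> 0"
  using alg_indep_nonzero[OF K_semiring indep] by simp

definition mon :: "(nat \<Rightarrow>\<^sub>0 int) \<Rightarrow> 'a" where
  "mon e = (\<Prod>j<m. x j powi Poly_Mapping.lookup e j)"

lemma mon_add: "mon (a + b) = mon a * mon b"
  unfolding mon_def prod.distrib[symmetric]
  by (rule prod.cong) (simp_all add: lookup_add power_int_add x_nonzero)

lemma mon_zero [simp]: "mon 0 = 1"
  by (simp add: mon_def)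

lemma mon_expo: "mon (expo m v) = laurent_monomial m x v"
  by (simp add: mon_def laurent_monomial_def)

definition lpoly :: "'a set \<Rightarrow> ((nat \<Rightarrow>\<^sub>0 int) \<Rightarrow>\<^sub>0 'a) \<Rightarrow> bool" where
  "lpoly C P \<longleftrightarrow> (\<forall>e. Poly_Mapping.lookup P e \<in> C) \<and>
     (\<forall>e\<in>Poly_Mapping.keys P. Poly_Mapping.keys e \<subseteq> {..<m})"

lemma lpoly_mono: "lpoly C P \<Longrightarrow> C \<subseteq> C' \<Longrightarrow> lpoly C' P"
  by (auto simp: lpoly_def)

lemma lpoly_add:
  assumes "is_subsemiring C" "lpoly C P" "lpoly C Q"
  shows "lpoly C (P + Q)"
  using assms keys_add[of P Q] unfolding lpoly_def is_subsemiring_def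
  by (auto simp: lookup_add) blast

lemma lpoly_mult:
  assumes "is_subsemiring C" "lpoly C P" "lpoly C Q"
  shows "lpoly C (P * Q)"
proof -
  have "Poly_Mapping.keys e \<subseteq> {..<m}" if "e \<in> Poly_Mapping.keys (P * Q)" for e
  proof -
    obtain a b where "e = a + b" "a \<in> Poly_Mapping.keys P" "b \<in> Poly_Mapping.keys Q"
      using keys_mult[of P Q] \<open>e \<in> Poly_Mapping.keys (P * Q)\<close> by blast
    then show ?thesis using keys_add[of a b] assms(2,3) unfolding lpoly_def by blast
  qed
  then show ?thesis
    using lookup_mult_in_subsemiring[OF assms(1), of P Q] assms(2,3) by (simp add: lpoly_def)
qed

lemma lpoly_diff:
  assumes "lpoly K P" "lpoly K Q"
  shows "lpoly K (P - Q)"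
proof -
  have "lpoly K (- Q)"
    using assms(2) K by (auto simp: lpoly_def is_subfield_def is_subring_def in_keys_iff)
  then show ?thesis
    using lpoly_add[OF K_semiring assms(1), of "- Q"] by simp
qed

lemma lpoly_single:
  assumes "is_subsemiring C" "c \<in> C" "Poly_Mapping.keys e \<subseteq> {..<m}"
  shows "lpoly C (Poly_Mapping.single e c)"
  using assms by (auto simp: lpoly_def lookup_single when_def is_subsemiring_def)

lemma meval_mon_mult: "meval mon (P * Q) = meval mon P * meval mon Q"
  by (rule meval_mult) (rule mon_add)

lemma meval_eq_0D:
  assumes P: "lpoly K P" and 0: "meval mon P = 0"
  shows "P = 0"
proof -
  define B where "B = (\<Sum>e\<in>Poly_Mapping.keys P. \<Sum>j<m. \<bar>Poly_Mapping.lookup e j\<bar>)"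
  have B: "0 \<le> B + Poly_Mapping.lookup e j" if "e \<in> Poly_Mapping.keys P" "j < m" for e j
  proof -
    have "\<bar>Poly_Mapping.lookup e j\<bar> \<le> (\<Sum>j<m. \<bar>Poly_Mapping.lookup e j\<bar>)"
      using that by (intro member_le_sum) auto
    also have "\<dots> \<le> B"
      unfolding B_def by (rule member_le_sum[where f = "\<lambda>e. \<Sum>j<m. \<bar>Poly_Mapping.lookup e j\<bar>"])
        (use that in \<open>auto intro: sum_nonneg\<close>)
    finally show ?thesis by linarith
  qed
  define sh where "sh e = (Abs_poly_mapping (\<lambda>j. if j < m then nat (B + Poly_Mapping.lookup e j) else 0) :: nat \<Rightarrow>\<^sub>0 nat)"
    for e :: "nat \<Rightarrow>\<^sub>0 int"
  have sh: "Poly_Mapping.lookup (sh e) j = (if j < m then nat (B + Poly_Mapping.lookup e j) else 0)" for e j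
  proof -
    have "finite {j. (if j < m then nat (B + Poly_Mapping.lookup e j) else 0) \<noteq> 0}"
      by (rule finite_subset[of _ "{..<m}"]) auto
    then show ?thesis by (simp add: sh_def)
  qed
  have sh_keys: "Poly_Mapping.keys (sh e) \<subseteq> {..<m}" for e
    by (auto simp: in_keys_iff sh split: if_splits)
  have inj: "inj_on sh (Poly_Mapping.keys P)"
  proof (rule inj_onI, rule poly_mapping_eqI)
    fix a b j assume ab: "a \<in> Poly_Mapping.keys P" "b \<in> Poly_Mapping.keys P" "sh a = sh b"
    show "Poly_Mapping.lookup a j = Poly_Mapping.lookup b j"
    proof (cases "j < m")
      case True
      then show ?thesis
        using arg_cong[OF ab(3), of "\<lambda>p. Poly_Mapping.lookup p j"] B[OF ab(1) True] B[OF ab(2) True]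
        by (simp add: sh eq_nat_nat_iff)
    next
      case False
      then have "j \<notin> Poly_Mapping.keys a" "j \<notin> Poly_Mapping.keys b"
        using P ab by (auto simp: lpoly_def)
      then show ?thesis by (simp add: in_keys_iff)
    qed
  qed
  define p where "p = reindex sh P"
  note keys_p = keys_reindex[OF inj, folded p_def]
  have mon_sh: "(\<Prod>i\<in>Poly_Mapping.keys (sh e). x i ^ Poly_Mapping.lookup (sh e) i)
      = (\<Prod>j<m. x j powi B) * mon e" if "e \<in> Poly_Mapping.keys P" for e
  proof -
    have "(\<Prod>i\<in>Poly_Mapping.keys (sh e). x i ^ Poly_Mapping.lookup (sh e) i)
        = (\<Prod>i<m. x i ^ Poly_Mapping.lookup (sh e) i)"
      by (rule prod.mono_neutral_left) (use sh_keys in \<open>auto simp: in_keys_iff\<close>)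
    also have "\<dots> = (\<Prod>j<m. x j powi B * x j powi Poly_Mapping.lookup e j)"
    proof (rule prod.cong)
      fix j assume "j \<in> {..<m}"
      then show "x j ^ Poly_Mapping.lookup (sh e) j = x j powi B * x j powi Poly_Mapping.lookup e j"
        using B[OF that, of j] power_int_add[of "x j" B "Poly_Mapping.lookup e j"] x_nonzero[of j]
        by (auto simp: sh power_int_def[of "x j" "B + _"])
    qed simp
    finally show ?thesis by (simp add: mon_def prod.distrib)
  qed
  have "poly_eval x p = meval (\<lambda>\<nu>. \<Prod>i\<in>Poly_Mapping.keys \<nu>. x i ^ Poly_Mapping.lookup \<nu> i) p"
    by (simp add: poly_eval_def meval_def)
  also have "\<dots> = (\<Sum>e\<in>Poly_Mapping.keys P. (\<Prod>j<m. x j powi B) * (Poly_Mapping.lookup P e * mon e))"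
    unfolding p_def meval_reindex by (rule sum.cong) (simp_all add: mon_sh)
  also have "\<dots> = 0" using 0 by (simp add: meval_def sum_distrib_left[symmetric])
  finally have "poly_eval x p = 0" .
  moreover have "Poly_Mapping.lookup p \<nu> \<in> K" for \<nu>
    unfolding p_def
    by (rule lookup_reindex_in[OF inj]) (use P K_semiring in \<open>auto simp: lpoly_def is_subsemiring_def\<close>)
  then have "poly_over K {..<m} p"
    using sh_keys by (auto simp: poly_over_def keys_p)
  ultimately have "p = 0" using indep by (auto simp: alg_indep_def)
  then show "P = 0" using keys_p keys_nonempty[of P] by fastforce
qed

lemma meval_inj:
  assumes "lpoly K P" "lpoly K Q" "meval mon P = meval mon Q"
  shows "P = Q"
proof -
  have "meval mon P = meval mon (P - Q) + meval mon Q"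
    using meval_add[of mon "P - Q" Q] by simp
  then show ?thesis
    using meval_eq_0D[OF lpoly_diff[OF assms(1,2)]] assms(3) by simp
qed

definition wt :: "int vec \<Rightarrow> (nat \<Rightarrow>\<^sub>0 int) \<Rightarrow> int" where
  "wt w e = (\<Sum>j<m. w $ j * Poly_Mapping.lookup e j)"

lemma wt_add: "wt w (a + b) = wt w a + wt w b"
  by (simp add: wt_def lookup_add distrib_left sum.distrib)

definition has_val :: "int vec \<Rightarrow> 'a \<Rightarrow> int \<Rightarrow> bool" where
  "has_val w u c \<longleftrightarrow> (\<exists>P Q. P \<noteq> 0 \<and> Q \<noteq> 0 \<and> lpoly N P \<and> lpoly N Q \<and>
     u * meval mon Q = meval mon P \<and> c = wmax (wt w) P - wmax (wt w) Q)"

lemma keys_add_cone: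
  assumes "lpoly N P" "lpoly N Q"
  shows "Poly_Mapping.keys (P + Q) = Poly_Mapping.keys P \<union> Poly_Mapping.keys Q"
proof -
  have "Poly_Mapping.lookup P e = 0 \<and> Poly_Mapping.lookup Q e = 0"
    if "Poly_Mapping.lookup P e + Poly_Mapping.lookup Q e = 0" for e
    using N_cone[of "Poly_Mapping.lookup P e" "Poly_Mapping.lookup Q e"] assms that
    by (auto simp: lpoly_def)
  then show ?thesis by (auto simp: in_keys_iff lookup_add)
qed

lemma has_val_add:
  assumes "has_val w a c" "has_val w b d"
  shows "has_val w (a + b) (max c d)"
proof -
  obtain P Q where PQ: "P \<noteq> 0" "Q \<noteq> 0" "lpoly N P" "lpoly N Q" "a * meval mon Q = meval mon P"
    "c = wmax (wt w) P - wmax (wt w) Q" using assms(1) unfolding has_val_def by auto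
  obtain P' Q' where PQ': "P' \<noteq> 0" "Q' \<noteq> 0" "lpoly N P'" "lpoly N Q'" "b * meval mon Q' = meval mon P'"
    "d = wmax (wt w) P' - wmax (wt w) Q'" using assms(2) unfolding has_val_def by auto
  have l: "lpoly N (P * Q')" "lpoly N (P' * Q)" "lpoly N (Q * Q')"
    using PQ PQ' by (auto intro: lpoly_mult N)
  note keys = keys_add_cone[OF l(1,2)]
  have nz: "P * Q' \<noteq> 0" "P' * Q \<noteq> 0" using PQ PQ' by auto
  have "wmax (wt w) (P * Q' + P' * Q) = max (wmax (wt w) (P * Q')) (wmax (wt w) (P' * Q))"
    unfolding wmax_def keys image_Un by (rule Max_Un) (use nz keys_nonempty in auto)
  then have "max c d = wmax (wt w) (P * Q' + P' * Q) - wmax (wt w) (Q * Q')"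
    using PQ PQ' by (simp add: wmax_mult wt_add)
  moreover have "P * Q' + P' * Q \<noteq> 0"
    using keys keys_nonempty[OF nz(1)] by fastforce
  moreover have "(a + b) * meval mon (Q * Q') = meval mon (P * Q' + P' * Q)"
    unfolding meval_add meval_mon_mult PQ(5)[symmetric] PQ'(5)[symmetric] by (simp add: algebra_simps)
  ultimately show ?thesis
    unfolding has_val_def using l PQ(2) PQ'(2) lpoly_add[OF N l(1,2)]
    by (intro exI[of _ "P * Q' + P' * Q"] exI[of _ "Q * Q'"]) simp
qed

lemma has_val_mult:
  assumes "has_val w a c" "has_val w b d"
  shows "has_val w (a * b) (c + d)"
proof -
  obtain P Q where PQ: "P \<noteq> 0" "Q \<noteq> 0" "lpoly N P" "lpoly N Q" "a * meval mon Q = meval mon P"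
    "c = wmax (wt w) P - wmax (wt w) Q" using assms(1) unfolding has_val_def by auto
  obtain P' Q' where PQ': "P' \<noteq> 0" "Q' \<noteq> 0" "lpoly N P'" "lpoly N Q'" "b * meval mon Q' = meval mon P'"
    "d = wmax (wt w) P' - wmax (wt w) Q'" using assms(2) unfolding has_val_def by auto
  have "(a * b) * meval mon (Q * Q') = meval mon (P * P')"
    unfolding meval_mon_mult PQ(5)[symmetric] PQ'(5)[symmetric] by (simp add: algebra_simps)
  then show ?thesis
    unfolding has_val_def using PQ PQ' lpoly_mult[OF N]
    by (intro exI[of _ "P * P'"] exI[of _ "Q * Q'"]) (simp add: wmax_mult wt_add)
qed

lemma has_val_inverse:
  assumes "has_val w a c"
  shows "has_val w (inverse a) (- c)"
proof -
  obtain P Q where PQ: "P \<noteq> 0" "Q \<noteq> 0" "lpoly N P" "lpoly N Q" "a * meval mon Q = meval mon P"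
    "c = wmax (wt w) P - wmax (wt w) Q" using assms(1) unfolding has_val_def by auto
  have "meval mon P \<noteq> 0" using meval_eq_0D[OF lpoly_mono[OF PQ(3) N_K]] PQ(1) by auto
  then have "a \<noteq> 0" using PQ(5) by auto
  then have "inverse a * meval mon P = meval mon Q"
    unfolding PQ(5)[symmetric] by simp
  then show ?thesis
    unfolding has_val_def using PQ by (intro exI[of _ P] exI[of _ Q] exI[of _ Q] exI[of _ P]) auto
qed

lemma has_val_divide:
  assumes "has_val w a c" "has_val w b d"
  shows "has_val w (a / b) (c - d)"
  using has_val_mult[OF assms(1) has_val_inverse[OF assms(2)]] by (simp add: divide_inverse)

lemma wt_zero [simp]: "wt w 0 = 0"
  by (simp add: wt_def)

lemma has_val_single:
  assumes "c \<in> N" "c \<noteq> 0" "Poly_Mapping.keys e \<subseteq> {..<m}"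
  shows "has_val w (c * mon e) (wt w e)"
proof -
  have "1 \<in> N" using N by (simp add: is_subsemiring_def)
  then show ?thesis
    unfolding has_val_def using assms single_neq_0[of c e] single_neq_0[of "1 :: 'a" "0 :: nat \<Rightarrow>\<^sub>0 int"]
    by (intro exI[of _ "Poly_Mapping.single e c"] exI[of _ "Poly_Mapping.single 0 1"])
      (simp add: lpoly_single N del: single_one)
qed

lemma has_val_const: "c \<in> N \<Longrightarrow> c \<noteq> 0 \<Longrightarrow> has_val w c 0"
  using has_val_single[of c 0 w] by simp

lemma has_val_monomial: "has_val w (laurent_monomial m x v) (\<Sum>j<m. w $ j * v $ j)"
proof -
  have "has_val w (1 * mon (expo m v)) (wt w (expo m v))"
    by (rule has_val_single) (use N keys_expo in \<open>auto simp: is_subsemiring_def\<close>)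
  then show ?thesis by (simp add: mon_expo wt_def)
qed

lemma has_val_var:
  assumes "j < m"
  shows "has_val w (x j) (w $ j)"
proof -
  have "has_val w (1 * mon (Poly_Mapping.single j 1)) (wt w (Poly_Mapping.single j 1))"
    by (rule has_val_single) (use N assms in \<open>auto simp: is_subsemiring_def\<close>)
  moreover have "mon (Poly_Mapping.single j 1) = x j"
  proof -
    have "mon (Poly_Mapping.single j 1) = (\<Prod>i<m. if i = j then x i else 1)"
      unfolding mon_def by (rule prod.cong) (auto simp: lookup_single when_def)
    then show ?thesis using assms by simp
  qed
  moreover have "wt w (Poly_Mapping.single j 1) = w $ j"
  proof -
    have "wt w (Poly_Mapping.single j 1) = (\<Sum>i<m. if i = j then w $ i else 0)"
      unfolding wt_def by (rule sum.cong) (auto simp: lookup_single when_def)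
    then show ?thesis using assms by simp
  qed
  ultimately show ?thesis by simp
qed

lemma has_val_power: "has_val w a c \<Longrightarrow> has_val w (a ^ k) (int k * c)"
proof (induction k)
  case 0
  then show ?case using has_val_const[of 1 w] N by (simp add: is_subsemiring_def)
next
  case (Suc k)
  then show ?case using has_val_mult[of w a c "a ^ k" "int k * c"] by (simp add: algebra_simps)
qed

lemma wmax_eq_of_has_val:
  assumes "has_val w u c" "lpoly K G" "u = meval mon G" "G \<noteq> 0"
  shows "wmax (wt w) G = c"
proof -
  obtain P Q where PQ: "P \<noteq> 0" "Q \<noteq> 0" "lpoly N P" "lpoly N Q" "u * meval mon Q = meval mon P"
    "c = wmax (wt w) P - wmax (wt w) Q" using assms(1) unfolding has_val_def by auto
  have "G * Q = P"
    by (rule meval_inj) (use PQ assms lpoly_mono[OF _ N_K] in \<open>auto simp: meval_mon_mult intro: lpoly_mult K_semiring\<close>)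
  then have "wmax (wt w) P = wmax (wt w) G + wmax (wt w) Q"
    using wmax_mult[of "wt w" G Q] wt_add assms(4) PQ(2) by auto
  then show ?thesis using PQ by simp
qed

end

section \<open>The coefficient rings\<close>

lemma is_subsemiring_hull: "is_subsemiring (is_subsemiring hull A)"
  by (rule hull_in) (auto simp: is_subsemiring_def)

lemma is_subring_hull: "is_subring (is_subring hull A)"
  by (rule hull_in) (auto simp: is_subring_def is_subsemiring_def)

lemma is_subfield_hull: "is_subfield (is_subfield hull A)"
  by (rule hull_in) (auto simp: is_subfield_def is_subring_def is_subsemiring_def)

lemma semiring_Nz_subset: "semiring_Nz S \<subseteq> field_Qz S"
  unfolding semiring_Nz_def field_Qz_def
  by (rule hull_antimono) (auto simp: is_subfield_def is_subring_def)

lemma ring_Zz_subset: "ring_Zz S \<subseteq> field_Qz S"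
  unfolding ring_Zz_def field_Qz_def
  by (rule hull_antimono) (auto simp: is_subfield_def)

lemma poly_eval_eq_meval:
  "poly_eval f = meval (\<lambda>\<nu>. \<Prod>i\<in>Poly_Mapping.keys \<nu>. f i ^ Poly_Mapping.lookup \<nu> i)"
  by (auto simp: poly_eval_def meval_def)

lemma prod_keys_add:
  fixes a b :: "'i \<Rightarrow>\<^sub>0 nat" and f :: "'i \<Rightarrow> 'a::field"
  shows "(\<Prod>i\<in>Poly_Mapping.keys (a + b). f i ^ Poly_Mapping.lookup (a + b) i) =
    (\<Prod>i\<in>Poly_Mapping.keys a. f i ^ Poly_Mapping.lookup a i) *
    (\<Prod>i\<in>Poly_Mapping.keys b. f i ^ Poly_Mapping.lookup b i)"
proof -
  let ?A = "Poly_Mapping.keys a \<union> Poly_Mapping.keys b"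
  have *: "(\<Prod>i\<in>Poly_Mapping.keys c. f i ^ Poly_Mapping.lookup c i) = (\<Prod>i\<in>?A. f i ^ Poly_Mapping.lookup c i)"
    if "Poly_Mapping.keys c \<subseteq> ?A" for c
    by (rule prod.mono_neutral_left) (use that in \<open>auto simp: in_keys_iff\<close>)
  have "Poly_Mapping.keys (a + b) \<subseteq> ?A" by (rule keys_add)
  then show ?thesis
    by (subst (1 2 3) *) (auto simp: lookup_add power_add prod.distrib)
qed

lemma poly_eval_add: "poly_eval f (p + q) = poly_eval f p + poly_eval f q"
  by (simp add: poly_eval_eq_meval meval_add)

lemma poly_eval_mult: "poly_eval f (p * q) = poly_eval f p * poly_eval f q"
  unfolding poly_eval_eq_meval by (rule meval_mult) (rule prod_keys_add)

lemma poly_over_mult: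
  assumes C: "is_subsemiring C" and p: "poly_over C I p" and q: "poly_over C I q"
  shows "poly_over C I (p * q)"
proof -
  have "Poly_Mapping.keys \<nu> \<subseteq> I" if \<nu>: "\<nu> \<in> Poly_Mapping.keys (p * q)" for \<nu>
  proof -
    obtain a b where "\<nu> = a + b" "a \<in> Poly_Mapping.keys p" "b \<in> Poly_Mapping.keys q"
      using keys_mult[of p q] \<nu> by blast
    then show ?thesis using keys_add[of a b] p q unfolding poly_over_def by blast
  qed
  then show ?thesis
    using lookup_mult_in_subsemiring[OF C, of p q] p q by (simp add: poly_over_def)
qed

lemma poly_over_add:
  assumes C: "is_subsemiring C" and p: "poly_over C I p" and q: "poly_over C I q"
  shows "poly_over C I (p + q)"
  using assms keys_add[of p q] by (auto simp: poly_over_def is_subsemiring_def lookup_add) blast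

lemma z_set_var:
  assumes amb: "ambient_field S" and z: "z \<in> z_set S"
  obtains v where "v \<in> var_index S" "var_family S v = z"
proof -
  obtain i s where is': "z = zvar S i s" "i < n_mut S" "1 \<le> s" "s < rdeg S i"
    using z by (auto simp: z_set_def)
  define s' where "s' = (if 2 * s \<le> rdeg S i then s else rdeg S i - s)"
  have "zvar S i s = zvar S i (rdeg S i - s)"
    using amb is'(2) less_imp_le[OF is'(4)] unfolding ambient_field_def by blast
  then have "var_family S (Inl (i, s')) = z" using is' by (simp add: s'_def var_family_def)
  moreover have "Inl (i, s') \<in> var_index S" using is' by (auto simp: s'_def var_index_def)
  ultimately show ?thesis using that by blast
qed

lemma semiring_Nz_poly_eval:
  assumes amb: "ambient_field S" and a: "a \<in> semiring_Nz S"
  obtains p where "poly_over \<nat> (var_index S) p" "a = poly_eval (var_family S) p"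
proof -
  let ?A = "{poly_eval (var_family S) p | p. poly_over \<nat> (var_index S) p}"
  have Nats: "is_subsemiring (\<nat> :: 'a set)" by (simp add: is_subsemiring_def)
  have "z_set S \<subseteq> ?A"
  proof
    fix y assume "y \<in> z_set S"
    then obtain v where v: "v \<in> var_index S" "var_family S v = y"
      using z_set_var[OF amb] by blast
    let ?p = "Poly_Mapping.single (Poly_Mapping.single v 1) 1 :: (nat \<times> nat + nat \<Rightarrow>\<^sub>0 nat) \<Rightarrow>\<^sub>0 'a"
    have "y = poly_eval (var_family S) ?p"
      by (simp only: poly_eval_var v)
    moreover have "poly_over \<nat> (var_index S) ?p"
      by (rule poly_over_single) (use v in auto)
    ultimately show "y \<in> ?A" by blast
  qed
  moreover have "is_subsemiring ?A"
    unfolding is_subsemiring_def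
  proof (intro conjI ballI)
    have "poly_eval (var_family S) 0 = 0" "poly_over \<nat> (var_index S) (0 :: _ \<Rightarrow>\<^sub>0 'a)"
      by (simp_all add: poly_eval_def poly_over_def)
    then show "0 \<in> ?A" by (metis (mono_tags, lifting) mem_Collect_eq)
    have "poly_eval (var_family S) 1 = 1"
      by (simp add: poly_eval_def)
    moreover have "poly_over \<nat> (var_index S) (1 :: _ \<Rightarrow>\<^sub>0 'a)"
      by (auto simp: poly_over_def lookup_one when_def)
    ultimately show "1 \<in> ?A" by (metis (mono_tags, lifting) mem_Collect_eq)
    fix a b assume "a \<in> ?A" "b \<in> ?A"
    then obtain p q where "a = poly_eval (var_family S) p" "b = poly_eval (var_family S) q"
      "poly_over \<nat> (var_index S) p" "poly_over \<nat> (var_index S) q" by auto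
    then show "a + b \<in> ?A" "a * b \<in> ?A"
      using poly_over_add[OF Nats, of _ p q] poly_over_mult[OF Nats, of _ p q]
      by (metis (mono_tags, lifting) mem_Collect_eq poly_eval_add poly_eval_mult)+
  qed
  ultimately have "semiring_Nz S \<subseteq> ?A"
    unfolding semiring_Nz_def by (rule hull_minimal)
  then show ?thesis using a that by blast
qed

lemma semiring_Nz_cone:
  fixes S :: "'a::field_char_0 lp_triple"
  assumes amb: "ambient_field S" and ab: "a \<in> semiring_Nz S" "b \<in> semiring_Nz S" "a + b = 0"
  shows "a = 0"
proof -
  obtain p where p: "poly_over \<nat> (var_index S) p" "a = poly_eval (var_family S) p"
    using semiring_Nz_poly_eval[OF amb ab(1)] .
  obtain q where q: "poly_over \<nat> (var_index S) q" "b = poly_eval (var_family S) q"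
    using semiring_Nz_poly_eval[OF amb ab(2)] .
  have "poly_eval (var_family S) (p + q) = 0"
    using p q ab by (simp add: poly_eval_add)
  moreover have "poly_over \<rat> (var_index S) (p + q)"
  proof -
    have "poly_over \<nat> (var_index S) (p + q)"
      by (rule poly_over_add) (use p q in \<open>auto simp: is_subsemiring_def\<close>)
    then show ?thesis using Nats_subset_Rats by (auto simp: poly_over_def)
  qed
  ultimately have pq: "p + q = 0"
    using amb by (auto simp: ambient_field_def alg_indep_def)
  have "Poly_Mapping.lookup p \<nu> = 0" for \<nu>
  proof -
    obtain i j where ij: "Poly_Mapping.lookup p \<nu> = of_nat i" "Poly_Mapping.lookup q \<nu> = of_nat j"
      using p(1) q(1) unfolding poly_over_def by (metis Nats_cases)
    have "(of_nat (i + j) :: 'a) = Poly_Mapping.lookup (p + q) \<nu>"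
      by (simp add: lookup_add ij)
    then have "i + j = 0" unfolding pq by (simp only: lookup_zero of_nat_eq_0_iff)
    then show ?thesis by (simp add: ij)
  qed
  then have "p = 0" by (simp add: poly_mapping_eqI)
  then show ?thesis by (simp add: p(2) poly_eval_def)
qed

section \<open>Pointed elements at one seed\<close>

lemma power_int_sum:
  fixes a :: "'a::field"
  assumes "a \<noteq> 0"
  shows "a powi (\<Sum>i\<in>I. f i) = (\<Prod>i\<in>I. a powi f i)"
  by (induction I rule: infinite_finite_induct) (simp_all add: assms power_int_add)

definition exvec :: "nat \<Rightarrow> (nat \<Rightarrow>\<^sub>0 nat) \<Rightarrow> int vec" where
  "exvec n \<nu> = vec n (\<lambda>i. int (Poly_Mapping.lookup \<nu> i))"

lemma exvec_carrier [simp]: "exvec n \<nu> \<in> carrier_vec n"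
  by (simp add: exvec_def)

lemma dim_exvec [simp]: "dim_vec (exvec n \<nu>) = n"
  by (simp add: exvec_def)

lemma exvec_zero [simp]: "exvec n 0 = 0\<^sub>v n"
  by (auto simp: exvec_def)

locale lp_seed =
  fixes S :: "'a::field_char_0 lp_triple" and t :: "nat list"
  assumes triple: "langlands_poisson_triple S" and vertex: "t \<in> verts S"
begin

abbreviation "n \<equiv> n_mut S"
abbreviation "m \<equiv> n_var S"
abbreviation "x \<equiv> clus S t"
abbreviation "B \<equiv> exmat S t"
abbreviation "L \<equiv> lam S t"

lemma pattern: "cluster_pattern S"
  using triple by (simp add: langlands_poisson_triple_def)

lemma n_le_m: "n \<le> m"
  using pattern by (simp add: cluster_pattern_def)

lemma amb: "ambient_field S"
  using pattern by (simp add: cluster_pattern_def)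

lemma seed: "is_seed S t"
  using pattern vertex by (simp add: cluster_pattern_def)

lemma B_carrier [simp]: "B \<in> carrier_mat m n"
  using seed by (simp add: is_seed_def)

lemma L_carrier [simp]: "L \<in> carrier_mat m m"
  using triple vertex by (simp add: langlands_poisson_triple_def)

lemma dims [simp]: "dim_row B = m" "dim_col B = n" "dim_row L = m" "dim_col L = m"
  using B_carrier L_carrier by (auto simp del: B_carrier L_carrier)

lemma D0_carrier [simp]: "D0 S \<in> carrier_mat n m"
  by (simp add: D0_def)

lemma d_pos: "i < n \<Longrightarrow> 0 < ddiag S i"
  using triple by (simp add: langlands_poisson_triple_def)

lemma BL: "transpose_mat B * L = D0 S"
  using triple vertex by (simp add: langlands_poisson_triple_def)

lemma L_skew: "transpose_mat L = - L"
  using triple vertex by (simp add: langlands_poisson_triple_def)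

sublocale laurent_chart m x "field_Qz S" "semiring_Nz S"
proof
  show "is_subfield (field_Qz S)" unfolding field_Qz_def by (rule is_subfield_hull)
  show "alg_indep (field_Qz S) {..<m} x" using seed by (simp add: is_seed_def)
  show "is_subsemiring (semiring_Nz S)" unfolding semiring_Nz_def by (rule is_subsemiring_hull)
  show "semiring_Nz S \<subseteq> field_Qz S" by (rule semiring_Nz_subset)
  show "a = 0" if "a \<in> semiring_Nz S" "b \<in> semiring_Nz S" "a + b = 0" for a b
    by (rule semiring_Nz_cone[OF amb that])
qed

lemma D0_mult:
  assumes "v \<in> carrier_vec m" "i < n"
  shows "(D0 S *\<^sub>v v) $ i = ddiag S i * v $ i"
proof -
  have "(D0 S *\<^sub>v v) $ i = (\<Sum>j = 0..<m. (if i = j then ddiag S i else 0) * v $ j)"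
    using assms by (simp add: D0_def mult_mat_vec_def scalar_prod_def)
  also have "\<dots> = (\<Sum>j = 0..<m. if i = j then ddiag S i * v $ j else 0)"
    by (rule sum.cong) auto
  also have "\<dots> = ddiag S i * v $ i"
    using assms n_le_m by simp
  finally show ?thesis .
qed

lemma B_L_scalar:
  assumes "v \<in> carrier_vec m" "\<nu> \<in> carrier_vec n"
  shows "(L *\<^sub>v v) \<bullet> (B *\<^sub>v \<nu>) = (D0 S *\<^sub>v v) \<bullet> \<nu>"
proof -
  have "(L *\<^sub>v v) \<bullet> (B *\<^sub>v \<nu>) = (transpose_mat B *\<^sub>v (L *\<^sub>v v)) \<bullet> \<nu>"
    by (rule transpose_vec_mult_scalar[OF B_carrier, symmetric])
      (use assms in \<open>auto intro: mult_mat_vec_carrier[OF L_carrier]\<close>)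
  also have "transpose_mat B *\<^sub>v (L *\<^sub>v v) = D0 S *\<^sub>v v"
    unfolding BL[symmetric] by (rule assoc_mult_mat_vec[symmetric]) (use assms in auto)
  finally show ?thesis .
qed

lemma B_inj:
  assumes "\<nu> \<in> carrier_vec n" "\<nu>' \<in> carrier_vec n" "B *\<^sub>v \<nu> = B *\<^sub>v \<nu>'"
  shows "\<nu> = \<nu>'"
proof -
  have "\<nu> $ i = \<nu>' $ i" if i: "i < n" for i
  proof -
    let ?e = "unit_vec m i :: int vec"
    have D: "(D0 S *\<^sub>v ?e) = ddiag S i \<cdot>\<^sub>v unit_vec n i"
      by (rule eq_vecI) (use i n_le_m D0_mult in \<open>auto simp: D0_def\<close>)
    have "(D0 S *\<^sub>v ?e) \<bullet> \<nu> = (D0 S *\<^sub>v ?e) \<bullet> \<nu>'"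
      using B_L_scalar[of ?e] assms by (metis unit_vec_carrier)
    then have "ddiag S i * \<nu> $ i = ddiag S i * \<nu>' $ i"
      unfolding D using assms i by simp
    then show ?thesis using d_pos[OF i] by simp
  qed
  then show ?thesis using assms by auto
qed

definition shift :: "int vec \<Rightarrow> (nat \<Rightarrow>\<^sub>0 nat) \<Rightarrow> int vec" where
  "shift g \<nu> = g + B *\<^sub>v exvec n \<nu>"

lemma shift_carrier [simp]: "g \<in> carrier_vec m \<Longrightarrow> shift g \<nu> \<in> carrier_vec m"
  unfolding shift_def by (intro add_carrier_vec mult_mat_vec_carrier[OF B_carrier]) auto

lemma shift_zero [simp]: "g \<in> carrier_vec m \<Longrightarrow> shift g 0 = g"
proof -
  assume g: "g \<in> carrier_vec m"
  have "B *\<^sub>v 0\<^sub>v n = 0\<^sub>v m"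
    by (rule eq_vecI) (auto simp: scalar_prod_def)
  then show ?thesis using g by (simp add: shift_def)
qed

lemma exvec_inj:
  assumes "Poly_Mapping.keys \<nu> \<subseteq> {..<n}" "Poly_Mapping.keys \<nu>' \<subseteq> {..<n}" "exvec n \<nu> = exvec n \<nu>'"
  shows "\<nu> = \<nu>'"
proof (rule poly_mapping_eqI)
  fix i
  show "Poly_Mapping.lookup \<nu> i = Poly_Mapping.lookup \<nu>' i"
  proof (cases "i < n")
    case True
    then show ?thesis using arg_cong[OF assms(3), of "\<lambda>v. v $ i"] by (simp add: exvec_def)
  next
    case False
    then have "i \<notin> Poly_Mapping.keys \<nu>" "i \<notin> Poly_Mapping.keys \<nu>'" using assms by auto
    then show ?thesis by (simp add: in_keys_iff)
  qed
qed

lemma shift_inj: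
  assumes g: "g \<in> carrier_vec m"
  shows "inj_on (shift g) {\<nu>. Poly_Mapping.keys \<nu> \<subseteq> {..<n}}"
proof (rule inj_onI, clarify)
  fix \<nu> \<nu>' assume *: "Poly_Mapping.keys \<nu> \<subseteq> {..<n}" "Poly_Mapping.keys \<nu>' \<subseteq> {..<n}" "shift g \<nu> = shift g \<nu>'"
  have c: "B *\<^sub>v exvec n \<nu> \<in> carrier_vec m" "B *\<^sub>v exvec n \<nu>' \<in> carrier_vec m"
    by (auto intro: mult_mat_vec_carrier[OF B_carrier])
  have "(B *\<^sub>v exvec n \<nu>) $ j = (B *\<^sub>v exvec n \<nu>') $ j" if "j < m" for j
    using arg_cong[OF *(3), of "\<lambda>v. v $ j"] that g c by (simp add: shift_def)
  then have "B *\<^sub>v exvec n \<nu> = B *\<^sub>v exvec n \<nu>'" using c by auto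
  then show "\<nu> = \<nu>'" using B_inj exvec_inj * by simp
qed

lemma monomial_shift:
  assumes g: "g \<in> carrier_vec m" and \<nu>: "Poly_Mapping.keys \<nu> \<subseteq> {..<n}"
  shows "laurent_monomial m x (shift g \<nu>) = laurent_monomial m x g *
    (\<Prod>i\<in>Poly_Mapping.keys \<nu>. yhat S t i ^ Poly_Mapping.lookup \<nu> i)"
proof -
  have "shift g \<nu> $ j = g $ j + (\<Sum>i<n. B $$ (j, i) * int (Poly_Mapping.lookup \<nu> i))" if "j < m" for j
    using that g
    by (simp add: shift_def exvec_def scalar_prod_def atLeast0LessThan)
  then have "laurent_monomial m x (shift g \<nu>) =
      (\<Prod>j<m. x j powi (g $ j) * (\<Prod>i<n. (x j powi (B $$ (j, i))) ^ Poly_Mapping.lookup \<nu> i))"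
    unfolding laurent_monomial_def
    by (intro prod.cong) (auto simp: power_int_add x_nonzero power_int_sum power_int_mult)
  also have "\<dots> = laurent_monomial m x g * (\<Prod>i<n. \<Prod>j<m. (x j powi (B $$ (j, i))) ^ Poly_Mapping.lookup \<nu> i)"
    unfolding prod.distrib laurent_monomial_def by (subst prod.swap) (rule refl)
  also have "(\<Prod>i<n. \<Prod>j<m. (x j powi (B $$ (j, i))) ^ Poly_Mapping.lookup \<nu> i) =
      (\<Prod>i<n. yhat S t i ^ Poly_Mapping.lookup \<nu> i)"
  proof (rule prod.cong)
    fix i assume "i \<in> {..<n}"
    then have "yhat S t i = (\<Prod>j<m. x j powi (B $$ (j, i)))"
      unfolding yhat_def laurent_monomial_def by (intro prod.cong) auto
    then show "(\<Prod>j<m. (x j powi (B $$ (j, i))) ^ Poly_Mapping.lookup \<nu> i) = yhat S t i ^ Poly_Mapping.lookup \<nu> i"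
      by (simp only: prod_power_distrib)
  qed simp
  also have "\<dots> = (\<Prod>i\<in>Poly_Mapping.keys \<nu>. yhat S t i ^ Poly_Mapping.lookup \<nu> i)"
    by (rule prod.mono_neutral_right) (use \<nu> in \<open>auto simp: in_keys_iff\<close>)
  finally show ?thesis .
qed

abbreviation is_F :: "'a \<Rightarrow> int vec \<Rightarrow> ((nat \<Rightarrow>\<^sub>0 nat) \<Rightarrow>\<^sub>0 'a) \<Rightarrow> bool" where
  "is_F u g F \<equiv> poly_over (ring_Zz S) {..<n} F \<and> Poly_Mapping.lookup F 0 = 1 \<and>
     u = laurent_monomial m x g * poly_eval (yhat S t) F"

definition lexpand :: "int vec \<Rightarrow> ((nat \<Rightarrow>\<^sub>0 nat) \<Rightarrow>\<^sub>0 'a) \<Rightarrow> (nat \<Rightarrow>\<^sub>0 int) \<Rightarrow>\<^sub>0 'a" where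
  "lexpand g F = reindex (\<lambda>\<nu>. expo m (shift g \<nu>)) F"

lemma expo_shift_inj:
  assumes "g \<in> carrier_vec m"
  shows "inj_on (\<lambda>\<nu>. expo m (shift g \<nu>)) {\<nu>. Poly_Mapping.keys \<nu> \<subseteq> {..<n}}"
  using comp_inj_on[OF shift_inj[OF assms] inj_on_subset[OF inj_on_expo]] assms
  by (auto simp: comp_def image_subset_iff)

lemma
  assumes g: "g \<in> carrier_vec m" and F: "poly_over (ring_Zz S) {..<n} F"
  shows lpoly_lexpand: "lpoly (field_Qz S) (lexpand g F)"
    and meval_lexpand: "meval mon (lexpand g F) = laurent_monomial m x g * poly_eval (yhat S t) F"
    and keys_lexpand: "Poly_Mapping.keys (lexpand g F) = (\<lambda>\<nu>. expo m (shift g \<nu>)) ` Poly_Mapping.keys F"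
proof -
  have sub: "Poly_Mapping.keys F \<subseteq> {\<nu>. Poly_Mapping.keys \<nu> \<subseteq> {..<n}}"
    using F by (auto simp: poly_over_def)
  note inj = inj_on_subset[OF expo_shift_inj[OF g] sub]
  show keys: "Poly_Mapping.keys (lexpand g F) = (\<lambda>\<nu>. expo m (shift g \<nu>)) ` Poly_Mapping.keys F"
    unfolding lexpand_def by (rule keys_reindex[OF inj])
  have "Poly_Mapping.lookup (lexpand g F) h \<in> field_Qz S" for h
    unfolding lexpand_def
    by (rule lookup_reindex_in[OF inj])
      (use F ring_Zz_subset[of S] K_semiring in \<open>auto simp: poly_over_def is_subsemiring_def\<close>)
  then show "lpoly (field_Qz S) (lexpand g F)"
    using keys_expo[of m] unfolding lpoly_def keys by auto
  show "meval mon (lexpand g F) = laurent_monomial m x g * poly_eval (yhat S t) F"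
    unfolding lexpand_def meval_reindex poly_eval_def sum_distrib_left
    by (rule sum.cong) (use sub in \<open>auto simp: mon_expo monomial_shift[OF g]\<close>)
qed

lemma is_F_unique:
  assumes "g \<in> carrier_vec m" "is_F u g F" "is_F u g F'"
  shows "F = F'"
proof -
  have "lexpand g F = lexpand g F'"
    by (rule meval_inj) (use lpoly_lexpand[OF assms(1)] meval_lexpand[OF assms(1)] assms(2,3) in auto)
  then show ?thesis
    unfolding lexpand_def
    by (rule reindex_inj[OF expo_shift_inj[OF assms(1)], rotated 2]) (use assms in \<open>auto simp: poly_over_def\<close>)
qed

definition height :: "int vec \<Rightarrow> int" where
  "height h = (L *\<^sub>v vec m (\<lambda>_. 1)) \<bullet> h"

lemma height_shift:
  assumes "h \<in> carrier_vec m" "\<nu> \<in> carrier_vec n"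
  shows "height (h + B *\<^sub>v \<nu>) = height h + (\<Sum>i<n. ddiag S i * \<nu> $ i)"
proof -
  have "(L *\<^sub>v vec m (\<lambda>_. 1)) \<bullet> (h + B *\<^sub>v \<nu>) =
      (L *\<^sub>v vec m (\<lambda>_. 1)) \<bullet> h + (L *\<^sub>v vec m (\<lambda>_. 1)) \<bullet> (B *\<^sub>v \<nu>)"
    by (rule scalar_prod_add_distrib[of _ m])
      (use assms in \<open>auto intro: mult_mat_vec_carrier[OF B_carrier] mult_mat_vec_carrier[OF L_carrier]\<close>)
  also have "(L *\<^sub>v vec m (\<lambda>_. 1)) \<bullet> (B *\<^sub>v \<nu>) = (\<Sum>i<n. ddiag S i * \<nu> $ i)"
    using B_L_scalar[of "vec m (\<lambda>_. 1)" \<nu>] assms n_le_m D0_mult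
    by (simp add: scalar_prod_def atLeast0LessThan)
  finally show ?thesis by (simp add: height_def)
qed

lemma pointed_with_carrier: "pointed_with S t u g \<Longrightarrow> g \<in> carrier_vec m"
proof -
  assume "pointed_with S t u g"
  then obtain b :: "int vec \<Rightarrow>\<^sub>0 'a" where "Poly_Mapping.keys b \<subseteq> carrier_vec m" "Poly_Mapping.lookup b g = 1"
    unfolding pointed_with_def by blast
  then show ?thesis using in_keys_iff[of g b] by auto
qed

lemma dom_le_unique_maximal:
  assumes H: "finite H" "H \<subseteq> carrier_vec m" and max: "\<And>g'. dom_maximal S t H g' \<longleftrightarrow> g' = g" and h: "h \<in> H"
  shows "dom_le S t h g"
proof -
  define A where "A = {h'\<in>H. dom_le S t h h'}"
  have "dom_le S t h h"
    unfolding dom_le_def using H h shift_zero[of h]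
    by (intro bexI[of _ "0\<^sub>v n"]) (auto simp: shift_def)
  then have A: "finite A" "A \<noteq> {}" using H h by (auto simp: A_def)
  have "Min (height ` A) \<in> height ` A" using A by (intro Min_in) auto
  then obtain h' where h': "h' \<in> A" "height h' = Min (height ` A)" by auto
  have min: "height h' \<le> height a" if "a \<in> A" for a using h' A that by simp
  have "dom_maximal S t H h'"
    unfolding dom_maximal_def
  proof (intro conjI ballI impI)
    show "h' \<in> H" using h' by (simp add: A_def)
    fix a assume a: "a \<in> H" "dom_le S t h' a"
    obtain \<nu> where \<nu>: "\<nu> \<in> carrier_vec n" "\<forall>i<n. 0 \<le> \<nu> $ i" "h' = a + B *\<^sub>v \<nu>"
      using a unfolding dom_le_def by auto
    obtain \<nu>' where \<nu>': "\<nu>' \<in> carrier_vec n" "\<forall>i<n. 0 \<le> \<nu>' $ i" "h = h' + B *\<^sub>v \<nu>'"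
      using h' unfolding A_def dom_le_def by auto
    have ac: "a \<in> carrier_vec m" using a H by auto
    have Bc: "B *\<^sub>v \<nu> \<in> carrier_vec m" "B *\<^sub>v \<nu>' \<in> carrier_vec m"
      using \<nu> \<nu>' by (auto intro: mult_mat_vec_carrier[OF B_carrier])
    have "h = a + B *\<^sub>v (\<nu> + \<nu>')"
      using \<nu> \<nu>' ac Bc mult_add_distrib_mat_vec[OF B_carrier \<nu>(1) \<nu>'(1)]
      by (simp add: assoc_add_vec[of _ m])
    then have "dom_le S t h a"
      unfolding dom_le_def using \<nu> \<nu>' by (intro bexI[of _ "\<nu> + \<nu>'"]) auto
    then have "height h' \<le> height a" using a by (intro min) (simp add: A_def)
    then have "(\<Sum>i<n. ddiag S i * \<nu> $ i) \<le> 0"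
      using height_shift[OF ac \<nu>(1)] \<nu> by simp
    moreover have "0 \<le> ddiag S i * \<nu> $ i" if "i < n" for i
      using that \<nu> d_pos[of i] by simp
    ultimately have "\<forall>i\<in>{..<n}. ddiag S i * \<nu> $ i = 0"
      by (subst sum_nonneg_eq_0_iff[symmetric]) (auto intro!: antisym sum_nonneg)
    then have "\<nu> = 0\<^sub>v n" using d_pos \<nu> by (intro eq_vecI) fastforce+
    then show "a = h'" using \<nu> ac shift_zero[OF ac] by (simp add: shift_def)
  qed
  then have "h' = g" using max by blast
  then show ?thesis using h' by (simp add: A_def)
qed

lemma pointed_with_unique:
  assumes "pointed_with S t u g" "pointed_with S t u g'"
  shows "g = g'"
proof -
  have ex: "\<exists>b. Poly_Mapping.keys b \<subseteq> carrier_vec m \<and> lpoly (field_Qz S) (reindex (expo m) b) \<and>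
      u = meval mon (reindex (expo m) b) \<and> (\<forall>g'. dom_maximal S t (Poly_Mapping.keys b) g' \<longleftrightarrow> g' = g)"
    if "pointed_with S t u g" for g
  proof -
    obtain b :: "int vec \<Rightarrow>\<^sub>0 'a" where b: "Poly_Mapping.keys b \<subseteq> carrier_vec m"
      "\<forall>h. Poly_Mapping.lookup b h \<in> ring_Zz S"
      "u = (\<Sum>h\<in>Poly_Mapping.keys b. Poly_Mapping.lookup b h * laurent_monomial m x h)"
      "\<forall>g'. dom_maximal S t (Poly_Mapping.keys b) g' \<longleftrightarrow> g' = g"
      using \<open>pointed_with S t u g\<close> unfolding pointed_with_def by blast
    note inj = inj_on_subset[OF inj_on_expo b(1)]
    have "Poly_Mapping.lookup (reindex (expo m) b) h \<in> field_Qz S" for h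
      by (rule lookup_reindex_in[OF inj])
        (use b ring_Zz_subset[of S] K_semiring in \<open>auto simp: is_subsemiring_def\<close>)
    then have "lpoly (field_Qz S) (reindex (expo m) b)"
      using keys_expo[of m] unfolding lpoly_def keys_reindex[OF inj] by auto
    then show ?thesis using b by (intro exI[of _ b]) (simp add: meval_reindex mon_expo)
  qed
  obtain b b' where b: "Poly_Mapping.keys b \<subseteq> carrier_vec m" "lpoly (field_Qz S) (reindex (expo m) b)"
      "u = meval mon (reindex (expo m) b)" "\<forall>h. dom_maximal S t (Poly_Mapping.keys b) h \<longleftrightarrow> h = g"
    and b': "Poly_Mapping.keys b' \<subseteq> carrier_vec m" "lpoly (field_Qz S) (reindex (expo m) b')"
      "u = meval mon (reindex (expo m) b')" "\<forall>h. dom_maximal S t (Poly_Mapping.keys b') h \<longleftrightarrow> h = g'"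
    using ex[OF assms(1)] ex[OF assms(2)] by blast
  have "reindex (expo m) b = reindex (expo m) b'"
    by (rule meval_inj) (use b b' in auto)
  then have "b = b'" by (rule reindex_inj[OF inj_on_expo b(1) b'(1)])
  then show ?thesis using b(4) b'(4) by blast
qed

lemma deg_eq: "pointed_with S t u g \<Longrightarrow> deg S t u = g"
  unfolding deg_def using pointed_with_unique by blast

lemma pointed_with_deg: "pointed S t u \<Longrightarrow> pointed_with S t u (deg S t u)"
  unfolding pointed_def using deg_eq by metis

lemma deg_carrier: "pointed S t u \<Longrightarrow> deg S t u \<in> carrier_vec m"
  using pointed_with_deg pointed_with_carrier by blast

lemma is_F_exists:
  assumes "pointed_with S t u g"
  shows "\<exists>F. is_F u g F"
proof -
  obtain b :: "int vec \<Rightarrow>\<^sub>0 'a" where b: "Poly_Mapping.keys b \<subseteq> carrier_vec m"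
      "\<forall>h. Poly_Mapping.lookup b h \<in> ring_Zz S"
      "u = (\<Sum>h\<in>Poly_Mapping.keys b. Poly_Mapping.lookup b h * laurent_monomial m x h)"
      "\<forall>g'. dom_maximal S t (Poly_Mapping.keys b) g' \<longleftrightarrow> g' = g" "Poly_Mapping.lookup b g = 1"
    using assms unfolding pointed_with_def by blast
  have g: "g \<in> Poly_Mapping.keys b" "g \<in> carrier_vec m"
    using b pointed_with_carrier[OF assms] by (auto simp: in_keys_iff)
  have "\<exists>\<nu>. Poly_Mapping.keys \<nu> \<subseteq> {..<n} \<and> h = shift g \<nu>" if h: "h \<in> Poly_Mapping.keys b" for h
  proof -
    have "dom_le S t h g" by (rule dom_le_unique_maximal[OF _ b(1) _ h]) (use b in auto)
    then obtain v where v: "v \<in> carrier_vec n" "\<forall>i<n. 0 \<le> v $ i" "h = g + B *\<^sub>v v"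
      unfolding dom_le_def by auto
    define \<nu> where "\<nu> = Abs_poly_mapping (\<lambda>i. if i < n then nat (v $ i) else 0)"
    have "finite {i. (if i < n then nat (v $ i) else 0) \<noteq> 0}"
      by (rule finite_subset[of _ "{..<n}"]) auto
    then have l: "Poly_Mapping.lookup \<nu> i = (if i < n then nat (v $ i) else 0)" for i
      by (simp add: \<nu>_def)
    have "exvec n \<nu> = v" using v by (intro eq_vecI) (auto simp: exvec_def l)
    moreover have "Poly_Mapping.keys \<nu> \<subseteq> {..<n}" by (auto simp: in_keys_iff l split: if_splits)
    ultimately show ?thesis using v by (auto simp: shift_def)
  qed
  then obtain f where f: "\<And>h. h \<in> Poly_Mapping.keys b \<Longrightarrow> Poly_Mapping.keys (f h) \<subseteq> {..<n} \<and> h = shift g (f h)"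
    by metis
  have inj: "inj_on f (Poly_Mapping.keys b)" using f by (metis inj_onI)
  have "shift g (f g) = shift g 0" using f[OF g(1)] g by simp
  then have fg: "f g = 0"
    using shift_inj[OF g(2)] f[OF g(1)] by (auto simp: inj_on_def)
  define F where "F = reindex f b"
  have "0 \<in> ring_Zz S"
    using is_subring_hull[of "z_set S"] by (simp add: ring_Zz_def is_subring_def is_subsemiring_def)
  then have "Poly_Mapping.lookup F \<nu> \<in> ring_Zz S" for \<nu>
    unfolding F_def by (rule lookup_reindex_in[OF inj]) (use b in simp)
  then have "poly_over (ring_Zz S) {..<n} F"
    using f by (auto simp: poly_over_def F_def keys_reindex[OF inj])
  moreover have "Poly_Mapping.lookup F 0 = 1"
    using lookup_reindex[OF inj order_refl g(1)] b(5) by (simp add: F_def fg)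
  moreover have "u = laurent_monomial m x g * poly_eval (yhat S t) F"
    unfolding F_def poly_eval_eq_meval meval_reindex sum_distrib_left b(3)
  proof (rule sum.cong)
    fix h assume h: "h \<in> Poly_Mapping.keys b"
    have "laurent_monomial m x h = laurent_monomial m x g *
        (\<Prod>i\<in>Poly_Mapping.keys (f h). yhat S t i ^ Poly_Mapping.lookup (f h) i)"
      using monomial_shift[OF g(2), of "f h"] f[OF h] by simp
    then show "Poly_Mapping.lookup b h * laurent_monomial m x h = laurent_monomial m x g *
        (Poly_Mapping.lookup b h * (\<Prod>i\<in>Poly_Mapping.keys (f h). yhat S t i ^ Poly_Mapping.lookup (f h) i))"
      by simp
  qed simp
  ultimately show ?thesis by blast
qed

lemma is_F_F_poly:
  assumes "pointed S t u"
  shows "is_F u (deg S t u) (F_poly S t u)"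
  unfolding F_poly_def
  by (rule theI'[of "is_F u (deg S t u)"])
    (use is_F_exists[OF pointed_with_deg[OF assms]] is_F_unique[OF deg_carrier[OF assms]] in blast)

lemma F_poly_eq:
  assumes "pointed S t u" "is_F u (deg S t u) F"
  shows "F_poly S t u = F"
  using is_F_unique[OF deg_carrier[OF assms(1)] is_F_F_poly[OF assms(1)] assms(2)] .

end

section \<open>The pairing as a tropical valuation\<close>

text \<open>The pairing of \<open>u\<close> with the good element of degree \<open>q\<close> at \<open>t\<close>; only that degree enters.\<close>

definition deg_pairing :: "'a::field lp_triple \<Rightarrow> nat list \<Rightarrow> 'a \<Rightarrow> int vec \<Rightarrow> int" where
  "deg_pairing S t u q = deg S t u \<bullet> (lam S t *\<^sub>v q) + max_deg S (F_poly S t u) (D0 S *\<^sub>v q)"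

lemma max_deg_eq_wmax:
  "max_deg S p h = wmax (\<lambda>\<nu>. \<Sum>i<n_mut S. int (Poly_Mapping.lookup \<nu> i) * h $ i) p"
  by (simp add: max_deg_def wmax_def)

lemma max_deg_nonneg: "Poly_Mapping.lookup F 0 = (1::'a::zero_neq_one) \<Longrightarrow> 0 \<le> max_deg S F h"
  unfolding max_deg_eq_wmax
  using wmax_ge[of 0 F "\<lambda>\<nu>. \<Sum>i<n_mut S. int (Poly_Mapping.lookup \<nu> i) * h $ i"]
  by (simp add: in_keys_iff)

lemma has_trop_value_eq:
  assumes "has_trop_value S F h c"
  shows "c = max_deg S F h"
proof -
  obtain P Q where PQ: "Poly_Mapping.lookup P 0 = 1" "Poly_Mapping.lookup Q 0 = 1" "F * Q = P"
      "c = max_deg S P h - max_deg S Q h"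
    using assms unfolding has_trop_value_def by auto
  have "P \<noteq> 0" "Q \<noteq> 0" using PQ by auto
  then have "F \<noteq> 0" using PQ by auto
  have "wmax (\<lambda>\<nu>. \<Sum>i<n_mut S. int (Poly_Mapping.lookup \<nu> i) * h $ i) (F * Q) =
      wmax (\<lambda>\<nu>. \<Sum>i<n_mut S. int (Poly_Mapping.lookup \<nu> i) * h $ i) F +
      wmax (\<lambda>\<nu>. \<Sum>i<n_mut S. int (Poly_Mapping.lookup \<nu> i) * h $ i) Q"
    using \<open>F \<noteq> 0\<close> \<open>Q \<noteq> 0\<close>
    by (intro wmax_mult) (simp_all add: lookup_add distrib_right sum.distrib)
  then show ?thesis using PQ by (simp add: max_deg_eq_wmax)
qed

lemma has_pairing_eq: "has_pairing S t u u' c \<Longrightarrow> c = deg_pairing S t u (deg S t u')"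
  unfolding has_pairing_def deg_pairing_def using has_trop_value_eq by blast

lemma (in lp_seed) L_mult_carrier [simp]: "v \<in> carrier_vec m \<Longrightarrow> L *\<^sub>v v \<in> carrier_vec m"
  by (rule mult_mat_vec_carrier[OF L_carrier])

lemma (in lp_seed) L_skew_scalar:
  assumes "v \<in> carrier_vec m" "w \<in> carrier_vec m"
  shows "v \<bullet> (L *\<^sub>v w) = - (w \<bullet> (L *\<^sub>v v))"
proof -
  have "v \<bullet> (L *\<^sub>v w) = (transpose_mat L *\<^sub>v v) \<bullet> w"
    by (rule transpose_vec_mult_scalar[OF L_carrier, symmetric]) (use assms in auto)
  also have "\<dots> = - ((L *\<^sub>v v) \<bullet> w)"
    unfolding L_skew using assms by simp
  also have "(L *\<^sub>v v) \<bullet> w = w \<bullet> (L *\<^sub>v v)"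
    by (rule comm_scalar_prod[of _ m]) (use assms in auto)
  finally show ?thesis .
qed

lemma (in lp_seed) wt_expo: "v \<in> carrier_vec m \<Longrightarrow> wt w (expo m v) = w \<bullet> v"
  by (simp add: wt_def scalar_prod_def atLeast0LessThan)

lemma (in lp_seed) deg_pairing_eqI:
  assumes u: "pointed S t u" and q: "q \<in> carrier_vec m" and val: "has_val (L *\<^sub>v q) u c"
  shows "deg_pairing S t u q = c"
proof -
  let ?w = "L *\<^sub>v q" and ?g = "deg S t u" and ?F = "F_poly S t u"
  let ?\<omega> = "\<lambda>\<nu>. \<Sum>i<n. int (Poly_Mapping.lookup \<nu> i) * (D0 S *\<^sub>v q) $ i"
  note F = is_F_F_poly[OF u] and g = deg_carrier[OF u]
  have F0: "?F \<noteq> 0" using F by auto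
  have dimD: "dim_vec (D0 S *\<^sub>v q) = n" by (simp add: D0_def)
  have w_shift: "wt ?w (expo m (shift ?g \<nu>)) = ?w \<bullet> ?g + ?\<omega> \<nu>" for \<nu>
  proof -
    have "wt ?w (expo m (shift ?g \<nu>)) = ?w \<bullet> (?g + B *\<^sub>v exvec n \<nu>)"
      using wt_expo g by (simp add: shift_def[symmetric])
    also have "\<dots> = ?w \<bullet> ?g + ?w \<bullet> (B *\<^sub>v exvec n \<nu>)"
      by (rule scalar_prod_add_distrib[of _ m])
        (use g q in \<open>auto intro: mult_mat_vec_carrier[OF B_carrier]\<close>)
    also have "?w \<bullet> (B *\<^sub>v exvec n \<nu>) = (D0 S *\<^sub>v q) \<bullet> exvec n \<nu>"
      by (rule B_L_scalar) (use q in auto)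
    also have "\<dots> = ?\<omega> \<nu>"
      by (simp add: scalar_prod_def exvec_def atLeast0LessThan mult.commute)
    finally show ?thesis .
  qed
  have keys: "Poly_Mapping.keys (lexpand ?g ?F) = (\<lambda>\<nu>. expo m (shift ?g \<nu>)) ` Poly_Mapping.keys ?F"
    using keys_lexpand[OF g] F by blast
  have "wmax (wt ?w) (lexpand ?g ?F) = c"
    by (rule wmax_eq_of_has_val[OF val])
      (use lpoly_lexpand[OF g] meval_lexpand[OF g] F keys keys_nonempty[OF F0] in auto)
  moreover have "wmax (wt ?w) (lexpand ?g ?F) = ?w \<bullet> ?g + max_deg S ?F (D0 S *\<^sub>v q)"
  proof -
    obtain \<nu> where \<nu>: "\<nu> \<in> Poly_Mapping.keys ?F" "?\<omega> \<nu> = wmax ?\<omega> ?F"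
      using wmax_attained[OF F0, of ?\<omega>] by blast
    show ?thesis
    proof (rule wmax_eqI)
      show "expo m (shift ?g \<nu>) \<in> Poly_Mapping.keys (lexpand ?g ?F)" using keys \<nu> by auto
      show "wt ?w (expo m (shift ?g \<nu>)) = ?w \<bullet> ?g + max_deg S ?F (D0 S *\<^sub>v q)"
        unfolding w_shift max_deg_eq_wmax \<nu>(2) ..
      show "wt ?w e \<le> ?w \<bullet> ?g + max_deg S ?F (D0 S *\<^sub>v q)"
        if "e \<in> Poly_Mapping.keys (lexpand ?g ?F)" for e
        using that wmax_ge[of _ ?F ?\<omega>] unfolding keys max_deg_eq_wmax by (auto simp: w_shift)
    qed
  qed
  moreover have "?w \<bullet> ?g = ?g \<bullet> ?w"
    by (rule comm_scalar_prod[of _ m]) (use g q in auto)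
  ultimately show ?thesis by (simp add: deg_pairing_def)
qed

lemma (in lp_seed) has_val_yhat:
  assumes q: "q \<in> carrier_vec m" and k: "k < n"
  shows "has_val (L *\<^sub>v q) (yhat S t k) (ddiag S k * q $ k)"
proof -
  have "B *\<^sub>v unit_vec n k = col B k"
    by (rule eq_vecI) (use k in auto)
  then have "(L *\<^sub>v q) \<bullet> col B k = ddiag S k * q $ k"
    using B_L_scalar[OF q, of "unit_vec n k"] k D0_mult[OF q k] by simp
  then have "(\<Sum>j<m. (L *\<^sub>v q) $ j * col B k $ j) = ddiag S k * q $ k"
    by (simp add: scalar_prod_def atLeast0LessThan)
  then show ?thesis
    using has_val_monomial[of "L *\<^sub>v q" "col B k"] by (simp add: yhat_def)
qed

lemma (in lp_seed) B_diag: "k < n \<Longrightarrow> B $$ (k, k) = 0"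
  using seed unfolding is_seed_def skew_symmetrizable_part_def
  by (metis equal_neg_zero less_numeral_extra(3) mult_eq_0_iff)

lemma (in lp_seed) z_in: "z \<in> z_set S \<Longrightarrow> z \<in> semiring_Nz S"
  unfolding semiring_Nz_def by (rule hull_inc)

lemma (in lp_seed) z_nonzero:
  assumes "z \<in> z_set S"
  shows "z \<noteq> 0"
proof -
  obtain v where v: "v \<in> var_index S" "var_family S v = z"
    using z_set_var[OF amb assms] .
  have "is_subsemiring (\<rat> :: 'a set)" by (simp add: is_subsemiring_def)
  then show ?thesis
    using alg_indep_nonzero[of "\<rat>" "var_index S" "var_family S" v] amb v by (simp add: ambient_field_def)
qed

lemma (in lp_seed) has_val_z: "z \<in> z_set S \<Longrightarrow> has_val w z 0"
  by (rule has_val_const) (simp_all add: z_in z_nonzero)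

lemma (in lp_seed) has_val_exchange_sum:
  assumes k: "k < n" and y: "has_val w y c" and c: "c \<le> 0"
  shows "has_val w (\<Sum>s\<le>rdeg S k. zvar S k s * y ^ s) 0"
proof -
  have one: "has_val w 1 0" using has_val_power[OF y, of 0] by simp
  have ends: "zvar S k 0 = 1" "zvar S k (rdeg S k) = 1"
    using amb k unfolding ambient_field_def by blast+
  have z: "has_val w (zvar S k s) 0" if "s \<le> rdeg S k" for s
  proof (cases "s = 0 \<or> s = rdeg S k")
    case True
    then show ?thesis using ends one by auto
  next
    case False
    then have "zvar S k s \<in> z_set S"
      unfolding z_set_def using that k by (intro CollectI exI[of _ k] exI[of _ s]) simp
    then show ?thesis by (rule has_val_z)
  qed
  have "has_val w (\<Sum>s\<le>N. zvar S k s * y ^ s) 0" if "N \<le> rdeg S k" for N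
    using that
  proof (induction N)
    case 0
    then show ?case using one ends by simp
  next
    case (Suc N)
    have "int (Suc N) * c \<le> 0" using c by (intro mult_nonneg_nonpos) simp_all
    then have "max 0 (0 + int (Suc N) * c) = 0" by simp
    then show ?case
      using has_val_add[OF Suc.IH has_val_mult[OF z[OF Suc.prems] has_val_power[OF y, of "Suc N"]]] Suc.prems
      by simp
  qed
  then show ?thesis by simp
qed

section \<open>Mutation invariance of the pairing\<close>

definition trop_mutation :: "'a lp_triple \<Rightarrow> nat \<Rightarrow> nat list \<Rightarrow> int vec \<Rightarrow> int vec \<Rightarrow> bool" where
  "trop_mutation S k t q q' \<longleftrightarrow> q' $ k = - (q $ k) \<and>
     (\<forall>i<n_var S. i \<noteq> k \<longrightarrow>
        q' $ i = q $ i + pos_part (int (rdeg S k) * dual_exmat S t $$ (k, i)) * q $ k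
          - int (rdeg S k) * dual_exmat S t $$ (k, i) * pos_part (q $ k))"

lemma tree_adj_lt: "tree_adj n k t t' \<Longrightarrow> k < n"
  by (auto simp: tree_adj_def tree_vertices_def)

lemma tree_adj_sym: "tree_adj n k t t' \<Longrightarrow> tree_adj n k t' t"
  by (auto simp: tree_adj_def)

locale lp_edge =
  fixes S :: "'a::field_char_0 lp_triple" and k :: nat and t t' :: "nat list"
  assumes triple: "langlands_poisson_triple S" and adj: "tree_adj (n_mut S) k t t'"
begin

sublocale lp_seed S t
  by unfold_locales (use triple adj in \<open>auto simp: tree_adj_def\<close>)

sublocale T: lp_seed S t'
  by unfold_locales (use triple adj in \<open>auto simp: tree_adj_def\<close>)

abbreviation "r \<equiv> int (rdeg S k)"

lemma k_lt: "k < n" "k < m"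
  using tree_adj_lt[OF adj] n_le_m by auto

lemma dual_entry: "i < m \<Longrightarrow> dual_exmat S t $$ (k, i) = - B $$ (i, k)"
  using k_lt by (simp add: dual_exmat_def)

abbreviation "E \<epsilon> \<equiv> E_mat S \<epsilon> k t"

lemma E_carrier [simp]: "E \<epsilon> \<in> carrier_mat m m"
  by (simp add: E_mat_def)

lemma E_dims [simp]: "dim_row (E \<epsilon>) = m" "dim_col (E \<epsilon>) = m"
  by (simp_all add: E_mat_def)

lemma E_mult:
  assumes "v \<in> carrier_vec m" "i < m"
  shows "(E \<epsilon> *\<^sub>v v) $ i =
    (if i = k then - v $ k else v $ i + pos_part (- \<epsilon> * B $$ (i, k) * r) * v $ k)"
proof -
  have "(E \<epsilon> *\<^sub>v v) $ i = (\<Sum>j<m. E \<epsilon> $$ (i, j) * v $ j)"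
    using assms by (simp add: scalar_prod_def atLeast0LessThan)
  also have "\<dots> = E \<epsilon> $$ (i, k) * v $ k + (\<Sum>j\<in>{..<m} - {k}. E \<epsilon> $$ (i, j) * v $ j)"
    by (rule sum.remove) (use k_lt in auto)
  also have "(\<Sum>j\<in>{..<m} - {k}. E \<epsilon> $$ (i, j) * v $ j) = (\<Sum>j\<in>{..<m} - {k}. if i = j then v $ j else 0)"
    by (rule sum.cong) (use assms in \<open>auto simp: E_mat_def\<close>)
  also have "\<dots> = (if i = k then 0 else v $ i)"
    using assms by (auto simp: sum.delta)
  finally show ?thesis using assms k_lt by (simp add: E_mat_def)
qed

lemma E_transpose_mult:
  assumes "w \<in> carrier_vec m" "i < m"
  shows "(transpose_mat (E \<epsilon>) *\<^sub>v w) $ i =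
    (if i = k then - w $ k + r * (\<Sum>j<m. pos_part (- \<epsilon> * B $$ (j, k)) * w $ j) else w $ i)"
proof -
  have *: "(transpose_mat (E \<epsilon>) *\<^sub>v w) $ i = (\<Sum>j<m. E \<epsilon> $$ (j, i) * w $ j)"
    using assms by (simp add: scalar_prod_def atLeast0LessThan)
  show ?thesis
  proof (cases "i = k")
    case True
    have "(\<Sum>j<m. E \<epsilon> $$ (j, i) * w $ j) = E \<epsilon> $$ (k, i) * w $ k + (\<Sum>j\<in>{..<m} - {k}. E \<epsilon> $$ (j, i) * w $ j)"
      by (rule sum.remove) (use k_lt in auto)
    also have "(\<Sum>j\<in>{..<m} - {k}. E \<epsilon> $$ (j, i) * w $ j) =
        (\<Sum>j\<in>{..<m} - {k}. r * (pos_part (- \<epsilon> * B $$ (j, k)) * w $ j))"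
    proof (rule sum.cong)
      fix j assume "j \<in> {..<m} - {k}"
      moreover have "pos_part (- \<epsilon> * B $$ (j, k) * r) = r * pos_part (- \<epsilon> * B $$ (j, k))"
        by (auto simp: pos_part_def max_def mult_le_0_iff zero_le_mult_iff)
      ultimately show "E \<epsilon> $$ (j, i) * w $ j = r * (pos_part (- \<epsilon> * B $$ (j, k)) * w $ j)"
        using True k_lt by (simp add: E_mat_def)
    qed simp
    also have "\<dots> = (\<Sum>j<m. r * (pos_part (- \<epsilon> * B $$ (j, k)) * w $ j))"
      using k_lt B_diag[of k] by (subst sum.remove[of "{..<m}" k]) (auto simp: pos_part_def)
    finally have "(\<Sum>j<m. E \<epsilon> $$ (j, i) * w $ j) =
        - w $ k + (\<Sum>j<m. r * (pos_part (- \<epsilon> * B $$ (j, k)) * w $ j))"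
      using True k_lt by (simp add: E_mat_def)
    then show ?thesis unfolding * sum_distrib_left using True by simp
  next
    case False
    have "(\<Sum>j<m. E \<epsilon> $$ (j, i) * w $ j) = (\<Sum>j<m. if j = i then w $ j else 0)"
      by (rule sum.cong) (use False assms in \<open>auto simp: E_mat_def\<close>)
    then show ?thesis unfolding * using False assms by simp
  qed
qed

text \<open>
  On the half-space \<open>\<epsilon> * q $ k \<le> 0\<close> the piecewise linear mutation of tropical points is the linear
  involution \<open>E \<epsilon>\<close>.
\<close>

lemma E_trop_mutation:
  assumes q: "q \<in> carrier_vec m" "q' \<in> carrier_vec m" and mu: "trop_mutation S k t q q'"
    and \<epsilon>: "\<epsilon> = 1 \<or> \<epsilon> = -1" "\<epsilon> * q $ k \<le> 0"
  shows "E \<epsilon> *\<^sub>v q' = q"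
proof (rule eq_vecI)
  fix i assume "i < dim_vec q"
  then have i: "i < m" using q by simp
  show "(E \<epsilon> *\<^sub>v q') $ i = q $ i"
  proof (cases "i = k")
    case True
    then show ?thesis unfolding E_mult[OF q(2) i] using mu by (simp add: trop_mutation_def)
  next
    case False
    have "q' $ i = q $ i + pos_part (- (r * B $$ (i, k))) * q $ k + r * B $$ (i, k) * pos_part (q $ k)"
      "q' $ k = - q $ k"
      using mu i False by (auto simp: trop_mutation_def dual_entry)
    moreover have "pos_part (r * B $$ (i, k)) = pos_part (- (r * B $$ (i, k))) + r * B $$ (i, k)"
      by (simp add: pos_part_def)
    ultimately show ?thesis
      unfolding E_mult[OF q(2) i]
      using \<epsilon> False by (auto simp: pos_part_def[of "q $ k"] algebra_simps)
  qed
qed (use q in simp)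

lemma lam_mutation: "\<epsilon> = 1 \<or> \<epsilon> = -1 \<Longrightarrow> lam S t' = transpose_mat (E \<epsilon>) * L * E \<epsilon>"
  using triple adj unfolding langlands_poisson_triple_def by blast

lemma lam_mult:
  assumes "\<epsilon> = 1 \<or> \<epsilon> = -1" and q': "q' \<in> carrier_vec m"
  shows "lam S t' *\<^sub>v q' = transpose_mat (E \<epsilon>) *\<^sub>v (L *\<^sub>v (E \<epsilon> *\<^sub>v q'))"
proof -
  have "lam S t' *\<^sub>v q' = (transpose_mat (E \<epsilon>) * L) *\<^sub>v (E \<epsilon> *\<^sub>v q')"
    unfolding lam_mutation[OF assms(1)]
    by (rule assoc_mult_mat_vec) (use q' in \<open>auto intro: mult_carrier_mat\<close>)
  also have "\<dots> = transpose_mat (E \<epsilon>) *\<^sub>v (L *\<^sub>v (E \<epsilon> *\<^sub>v q'))"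
    by (rule assoc_mult_mat_vec) (use q' in \<open>auto intro: mult_mat_vec_carrier[OF E_carrier]\<close>)
  finally show ?thesis .
qed

lemma lam_scalar:
  assumes "\<epsilon> = 1 \<or> \<epsilon> = -1" and "p' \<in> carrier_vec m" "q' \<in> carrier_vec m"
  shows "p' \<bullet> (lam S t' *\<^sub>v q') = (E \<epsilon> *\<^sub>v p') \<bullet> (L *\<^sub>v (E \<epsilon> *\<^sub>v q'))"
proof -
  have Eq: "E \<epsilon> *\<^sub>v q' \<in> carrier_vec m" "E \<epsilon> *\<^sub>v p' \<in> carrier_vec m"
    using assms by (auto intro: mult_mat_vec_carrier[OF E_carrier])
  have "p' \<bullet> (transpose_mat (E \<epsilon>) *\<^sub>v (L *\<^sub>v (E \<epsilon> *\<^sub>v q'))) =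
      (transpose_mat (E \<epsilon>) *\<^sub>v (L *\<^sub>v (E \<epsilon> *\<^sub>v q'))) \<bullet> p'"
    by (rule comm_scalar_prod[of _ m]) (use assms Eq in \<open>auto intro: mult_mat_vec_carrier[of _ m m]\<close>)
  also have "\<dots> = (L *\<^sub>v (E \<epsilon> *\<^sub>v q')) \<bullet> (E \<epsilon> *\<^sub>v p')"
    by (rule transpose_vec_mult_scalar[OF E_carrier]) (use assms Eq in auto)
  also have "\<dots> = (E \<epsilon> *\<^sub>v p') \<bullet> (L *\<^sub>v (E \<epsilon> *\<^sub>v q'))"
    by (rule comm_scalar_prod[of _ m]) (use assms Eq in auto)
  finally show ?thesis by (simp add: lam_mult[OF assms(1,3)])
qed

lemma has_val_new_var:
  assumes q: "q \<in> carrier_vec m" "q' \<in> carrier_vec m" and mu: "trop_mutation S k t q q'"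
    and i: "i < m"
  shows "has_val (L *\<^sub>v q) (clus S t' i) ((lam S t' *\<^sub>v q') $ i)"
proof -
  define \<epsilon> :: int where "\<epsilon> = (if q $ k \<le> 0 then 1 else -1)"
  have \<epsilon>: "\<epsilon> = 1 \<or> \<epsilon> = -1" "\<epsilon> * q $ k \<le> 0" by (auto simp: \<epsilon>_def)
  let ?w = "L *\<^sub>v q"
  have "lam S t' *\<^sub>v q' = transpose_mat (E \<epsilon>) *\<^sub>v ?w"
    using lam_mult[OF \<epsilon>(1) q(2)] E_trop_mutation[OF q mu \<epsilon>] by simp
  then have w': "(lam S t' *\<^sub>v q') $ i =
      (if i = k then - ?w $ k + r * (\<Sum>j<m. pos_part (- \<epsilon> * B $$ (j, k)) * ?w $ j) else ?w $ i)"
    using E_transpose_mult[of ?w i \<epsilon>] q i by simp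
  have "seed_mutation S k t t'"
    using pattern adj by (simp add: cluster_pattern_def)
  then have x': "clus S t' i = mutated_var S \<epsilon> k t i"
    using \<epsilon>(1) i unfolding seed_mutation_def by blast
  show ?thesis
  proof (cases "i = k")
    case False
    then show ?thesis using has_val_var[OF i, of ?w] by (simp add: x' w' mutated_var_def)
  next
    case True
    let ?v = "vec m (\<lambda>j. pos_part (- \<epsilon> * B $$ (j, k)))"
    have M: "has_val ?w (\<Prod>j<m. x j powi pos_part (- \<epsilon> * B $$ (j, k)))
        (\<Sum>j<m. pos_part (- \<epsilon> * B $$ (j, k)) * ?w $ j)"
      using has_val_monomial[of ?w ?v] by (simp add: laurent_monomial_def mult.commute)
    have y: "has_val ?w (yhat S t k powi \<epsilon>) (\<epsilon> * (ddiag S k * q $ k))"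
      using has_val_yhat[OF q(1) k_lt(1)] has_val_inverse[OF has_val_yhat[OF q(1) k_lt(1)]] \<epsilon>(1)
      by (auto simp: power_int_minus)
    have "ddiag S k * (\<epsilon> * q $ k) \<le> 0"
      by (rule mult_nonneg_nonpos[OF less_imp_le[OF d_pos[OF k_lt(1)]] \<epsilon>(2)])
    then have "\<epsilon> * (ddiag S k * q $ k) \<le> 0"
      by (simp only: mult.left_commute)
    note P = has_val_exchange_sum[OF k_lt(1) y this]
    have "clus S t' i = inverse (x k) * (\<Prod>j<m. x j powi pos_part (- \<epsilon> * B $$ (j, k))) ^ rdeg S k *
        (\<Sum>s\<le>rdeg S k. zvar S k s * (yhat S t k powi \<epsilon>) ^ s)"
      unfolding x' mutated_var_def using True by (simp add: power_int_mult)
    moreover have "(lam S t' *\<^sub>v q') $ i =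
        - ?w $ k + r * (\<Sum>j<m. pos_part (- \<epsilon> * B $$ (j, k)) * ?w $ j) + 0"
      unfolding w' by (simp only: if_P[OF True] add_0_right)
    ultimately show ?thesis
      using has_val_mult[OF has_val_mult[OF has_val_inverse[OF has_val_var[OF k_lt(2)]] has_val_power[OF M, of "rdeg S k"]] P]
      by (simp only:)
  qed
qed

lemma common_val:
  assumes q: "q \<in> carrier_vec m" "q' \<in> carrier_vec m" and mu: "trop_mutation S k t q q'"
    and u: "u \<in> subtraction_free S t'"
  shows "\<exists>c. has_val (L *\<^sub>v q) u c \<and> T.has_val (lam S t' *\<^sub>v q') u c"
proof -
  let ?A = "{u. \<exists>c. has_val (L *\<^sub>v q) u c \<and> T.has_val (lam S t' *\<^sub>v q') u c}"
  have "z_set S \<union> clus S t' ` {..<m} \<subseteq> ?A"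
    using has_val_z T.has_val_z has_val_new_var[OF q mu] T.has_val_var by blast
  moreover have "closed_subtraction_free ?A"
    unfolding closed_subtraction_free_def
  proof (intro ballI conjI)
    fix a b assume "a \<in> ?A" "b \<in> ?A"
    then obtain c d where c: "has_val (L *\<^sub>v q) a c" "T.has_val (lam S t' *\<^sub>v q') a c"
      and d: "has_val (L *\<^sub>v q) b d" "T.has_val (lam S t' *\<^sub>v q') b d" by blast
    show "a + b \<in> ?A" using has_val_add[OF c(1) d(1)] T.has_val_add[OF c(2) d(2)] by blast
    show "a * b \<in> ?A" using has_val_mult[OF c(1) d(1)] T.has_val_mult[OF c(2) d(2)] by blast
    show "a / b \<in> ?A" using has_val_divide[OF c(1) d(1)] T.has_val_divide[OF c(2) d(2)] by blast
  qed
  ultimately have "subtraction_free S t' \<subseteq> ?A"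
    unfolding subtraction_free_def by (rule hull_minimal)
  then show ?thesis using u by blast
qed

lemma deg_pairing_invariant:
  assumes "q \<in> carrier_vec m" "q' \<in> carrier_vec m" and "trop_mutation S k t q q'"
    and u: "u \<in> subtraction_free S t'" "pointed S t u" "pointed S t' u"
  shows "deg_pairing S t u q = deg_pairing S t' u q'"
proof -
  obtain c where "has_val (L *\<^sub>v q) u c" "T.has_val (lam S t' *\<^sub>v q') u c"
    using common_val[OF assms(1-4)] by blast
  then have "deg_pairing S t u q = c" "deg_pairing S t' u q' = c"
    using deg_pairing_eqI[OF u(2)] T.deg_pairing_eqI[OF u(3)] assms(1,2) by blast+
  then show ?thesis by simp
qed

end

lemma good_deg_pairing_step:
  assumes "langlands_poisson_triple S" and "good S u" and "good S u'" and adj: "tree_adj (n_mut S) k t t'"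
  shows "deg_pairing S t u (deg S t u') = deg_pairing S t' u (deg S t' u')"
proof -
  interpret lp_edge S k t t' by unfold_locales (use assms in auto)
  have v: "t \<in> verts S" "t' \<in> verts S" using adj by (auto simp: tree_adj_def)
  have "deg S t u' \<in> carrier_vec m" "deg S t' u' \<in> carrier_vec m"
    "trop_mutation S k t (deg S t u') (deg S t' u')"
    using assms v unfolding good_def tropical_point_def trop_mutation_def by blast+
  then show ?thesis
    by (rule deg_pairing_invariant) (use assms v in \<open>auto simp: good_def\<close>)
qed

lemma tree_adj_Cons: "k # t \<in> tree_vertices n \<Longrightarrow> tree_adj n k t (k # t)"
  by (cases t) (auto simp: tree_adj_def tree_vertices_def)

lemma tree_vertices_induct [consumes 1, case_names root step]:
  assumes "t \<in> tree_vertices n" and "P []"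
    and "\<And>k t t'. tree_adj n k t t' \<Longrightarrow> P t \<Longrightarrow> P t'"
  shows "P t"
  using assms(1)
proof (induction t)
  case (Cons k t)
  have "tree_adj n k t (k # t)" by (rule tree_adj_Cons[OF Cons.prems])
  then show ?case using Cons.IH assms(3) by (auto simp: tree_adj_def)
qed (rule assms(2))

lemma tree_neighbour:
  assumes "t \<in> tree_vertices n" "k < n"
  obtains t' where "tree_adj n k t t'"
proof (cases "\<exists>s. t = k # s")
  case True
  then show ?thesis using that assms(1) tree_adj_sym tree_adj_Cons by metis
next
  case False
  then have "k # t \<in> tree_vertices n"
    using assms by (cases t) (auto simp: tree_vertices_def)
  then show ?thesis using that tree_adj_Cons by blast
qed

lemma has_F_invariant_eq:
  assumes triple: "langlands_poisson_triple S" and F: "has_F_invariant S u u' c" and t: "t \<in> verts S"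
  shows "c = deg_pairing S t u (deg S t u') + deg_pairing S t u' (deg S t u)"
proof -
  let ?P = "\<lambda>t. deg_pairing S t u (deg S t u') + deg_pairing S t u' (deg S t u)"
  have good: "good S u" "good S u'" using F by (auto simp: has_F_invariant_def)
  have const: "?P s = ?P []" if "s \<in> verts S" for s
    using that
    by (induction rule: tree_vertices_induct)
      (simp_all add: good_deg_pairing_step[OF triple good] good_deg_pairing_step[OF triple good(2,1)])
  obtain s where "s \<in> verts S" "c = ?P s"
    using F has_pairing_eq unfolding has_F_invariant_def by blast
  then show ?thesis using const t by metis
qed

lemma frozen_clus:
  assumes triple: "langlands_poisson_triple S" and t: "t \<in> verts S" and j: "n_mut S \<le> j" "j < n_var S"
  shows "clus S t j = clus S [] j"
  using t
proof (induction rule: tree_vertices_induct)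
  case (step k t t')
  have "seed_mutation S k t t'"
    using triple step.hyps by (simp add: langlands_poisson_triple_def cluster_pattern_def)
  moreover have "j \<noteq> k" using tree_adj_lt[OF step.hyps] j by simp
  ultimately have "clus S t' j = clus S t j"
    using j unfolding seed_mutation_def by (auto simp: mutated_var_def)
  then show ?case using step.IH by simp
qed simp

section \<open>Vanishing F-invariants\<close>

context lp_seed
begin

abbreviation "e k \<equiv> unit_vec m k :: int vec"

lemma weight_D0:
  assumes "q \<in> carrier_vec m" "k < n" "\<And>i. i < n \<Longrightarrow> i \<noteq> k \<Longrightarrow> Poly_Mapping.lookup \<nu> i = 0 \<or> q $ i = 0"
  shows "(\<Sum>i<n. int (Poly_Mapping.lookup \<nu> i) * (D0 S *\<^sub>v q) $ i) =
    int (Poly_Mapping.lookup \<nu> k) * (ddiag S k * q $ k)"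
proof -
  have "(\<Sum>i<n. int (Poly_Mapping.lookup \<nu> i) * (D0 S *\<^sub>v q) $ i) =
      (\<Sum>i<n. if i = k then int (Poly_Mapping.lookup \<nu> i) * (ddiag S i * q $ i) else 0)"
  proof (rule sum.cong)
    fix i assume "i \<in> {..<n}"
    then have i: "i < n" by simp
    show "int (Poly_Mapping.lookup \<nu> i) * (D0 S *\<^sub>v q) $ i =
        (if i = k then int (Poly_Mapping.lookup \<nu> i) * (ddiag S i * q $ i) else 0)"
      unfolding D0_mult[OF assms(1) i] using assms(3)[OF i] by auto
  qed simp
  then show ?thesis using assms(2) by simp
qed

lemma max_deg_unit_eq_0_iff:
  assumes F: "Poly_Mapping.lookup F 0 = (1 :: 'a)" and k: "k < n"
  shows "max_deg S F (D0 S *\<^sub>v e k) = 0 \<longleftrightarrow> (\<forall>\<nu>\<in>Poly_Mapping.keys F. Poly_Mapping.lookup \<nu> k = 0)"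
proof -
  let ?\<omega> = "\<lambda>\<nu>. \<Sum>i<n. int (Poly_Mapping.lookup \<nu> i) * (D0 S *\<^sub>v e k) $ i"
  have \<omega>: "?\<omega> \<nu> = int (Poly_Mapping.lookup \<nu> k) * ddiag S k" for \<nu>
    using weight_D0[of "e k" k \<nu>] k n_le_m by simp
  have F0: "F \<noteq> 0" using F by auto
  show ?thesis
    unfolding max_deg_eq_wmax
  proof
    assume 0: "wmax ?\<omega> F = 0"
    show "\<forall>\<nu>\<in>Poly_Mapping.keys F. Poly_Mapping.lookup \<nu> k = 0"
    proof
      fix \<nu> assume "\<nu> \<in> Poly_Mapping.keys F"
      then have "?\<omega> \<nu> \<le> 0" unfolding 0[symmetric] by (rule wmax_ge)
      then have "int (Poly_Mapping.lookup \<nu> k) * ddiag S k \<le> 0" by (simp only: \<omega>)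
      then show "Poly_Mapping.lookup \<nu> k = 0"
        using d_pos[OF k] by (simp add: mult_le_0_iff)
    qed
  next
    assume 0: "\<forall>\<nu>\<in>Poly_Mapping.keys F. Poly_Mapping.lookup \<nu> k = 0"
    obtain \<nu> where "\<nu> \<in> Poly_Mapping.keys F" "?\<omega> \<nu> = wmax ?\<omega> F"
      using wmax_attained[OF F0, of ?\<omega>] by blast
    then show "wmax ?\<omega> F = 0" using 0 \<omega>[of \<nu>] by simp
  qed
qed

lemma laurent_monomial_unit: "k < m \<Longrightarrow> laurent_monomial m x (e k) = x k"
proof -
  assume k: "k < m"
  have "laurent_monomial m x (e k) = (\<Prod>j<m. if j = k then x j else 1)"
    unfolding laurent_monomial_def by (rule prod.cong) (use k in auto)
  then show ?thesis using k by simp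
qed

lemma one_in_Zz: "1 \<in> ring_Zz S" and zero_in_Zz: "0 \<in> ring_Zz S"
  using is_subring_hull[of "z_set S"] by (simp_all add: ring_Zz_def is_subring_def is_subsemiring_def)

lemma
  assumes k: "k < n" and p: "pointed S t (x k)"
  shows deg_var: "deg S t (x k) = e k" and F_poly_var: "F_poly S t (x k) = 1"
proof -
  have km: "k < m" using k n_le_m by simp
  have "x k \<in> upper_cluster_algebra S" using p by (auto simp: pointed_def pointed_with_def)
  then have "pointed_with S t (x k) (e k)"
    unfolding pointed_with_def
    by (intro conjI exI[of _ "Poly_Mapping.single (e k) 1"])
      (auto simp: dom_maximal_def lookup_single when_def zero_in_Zz one_in_Zz laurent_monomial_unit[OF km])
  then show deg: "deg S t (x k) = e k" by (rule deg_eq)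
  show "F_poly S t (x k) = 1"
    by (rule F_poly_eq[OF p])
      (auto simp: deg laurent_monomial_unit[OF km] poly_over_def lookup_one when_def poly_eval_def
        one_in_Zz zero_in_Zz)
qed

lemma has_F_invariant_var:
  assumes k: "k < n" and F: "has_F_invariant S (x k) u c"
  shows "c = max_deg S (F_poly S t u) (D0 S *\<^sub>v e k)"
proof -
  have p: "pointed S t (x k)" "pointed S t u"
    using F vertex by (auto simp: has_F_invariant_def good_def)
  have "max_deg S (1 :: _ \<Rightarrow>\<^sub>0 'a) h = 0" for h by (simp add: max_deg_def)
  moreover have "e k \<bullet> (L *\<^sub>v deg S t u) = - (deg S t u \<bullet> (L *\<^sub>v e k))"
    by (rule L_skew_scalar) (use deg_carrier[OF p(2)] in auto)
  ultimately show ?thesis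
    using has_F_invariant_eq[OF triple F vertex]
    by (simp add: deg_pairing_def deg_var[OF k p(1)] F_poly_var[OF k p(1)])
qed

lemma F_invariant_var_eq_0D:
  assumes k: "k < n" and F: "has_F_invariant S (x k) u 0"
  shows "\<forall>\<nu>\<in>Poly_Mapping.keys (F_poly S t u). Poly_Mapping.lookup \<nu> k = 0"
proof -
  have "pointed S t u" using F vertex by (auto simp: has_F_invariant_def good_def)
  then have "Poly_Mapping.lookup (F_poly S t u) 0 = 1" using is_F_F_poly by blast
  then show ?thesis
    using has_F_invariant_var[OF k F] max_deg_unit_eq_0_iff[OF _ k] by metis
qed

lemma cluster_monomial_mod_frozenI:
  assumes p: "pointed S t u"
    and F: "\<And>\<nu> i. \<nu> \<in> Poly_Mapping.keys (F_poly S t u) \<Longrightarrow> i < n \<Longrightarrow> Poly_Mapping.lookup \<nu> i = 0"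
    and nonneg: "\<And>i. i < n \<Longrightarrow> 0 \<le> deg S t u $ i"
  shows "cluster_monomial_mod_frozen S t u"
proof -
  define g where "g = deg S t u"
  let ?F = "F_poly S t u"
  have isF: "is_F u g ?F" unfolding g_def by (rule is_F_F_poly[OF p])
  note g = nonneg[folded g_def]
  have "Poly_Mapping.keys ?F \<subseteq> {0}"
  proof
    fix \<nu> assume \<nu>: "\<nu> \<in> Poly_Mapping.keys ?F"
    have "Poly_Mapping.lookup \<nu> i = 0" for i
    proof (cases "i < n")
      case True
      then show ?thesis using F \<nu> by blast
    next
      case False
      then show ?thesis using isF \<nu> unfolding poly_over_def by (metis in_keys_iff lessThan_iff subsetD)
    qed
    then show "\<nu> \<in> {0}" by (simp add: poly_mapping_eqI)
  qed
  then have "poly_eval (yhat S t) ?F = 1"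
    using isF by (subst poly_eval_eq_meval, subst meval_superset[of "{0}"]) auto
  then have u: "u = (\<Prod>j<m. x j powi (g $ j))"
    using isF by (metis laurent_monomial_def mult.right_neutral)
  have split: "{..<m} = {..<n} \<union> {n..<m}" "{..<n} \<inter> {n..<m} = {}" using n_le_m by auto
  note u
  also have "(\<Prod>j<m. x j powi (g $ j)) = (\<Prod>j\<in>{n..<m}. x j powi (g $ j)) * (\<Prod>j<n. x j powi (g $ j))"
    unfolding split(1)
    by (subst prod.union_disjoint) (use split(2) in \<open>auto simp: mult.commute\<close>)
  also have "(\<Prod>j\<in>{n..<m}. x j powi (g $ j)) = (\<Prod>j\<in>{n..<m}. clus S [] j powi (g $ j))"
    by (rule prod.cong) (use frozen_clus[OF triple vertex] in auto)
  also have "(\<Prod>j<n. x j powi (g $ j)) = (\<Prod>j<m. x j ^ (if j < n then nat (g $ j) else 0))"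
    unfolding split(1)
    by (subst prod.union_disjoint) (use split(2) g in \<open>auto simp: power_int_def\<close>)
  finally have "u = (\<Prod>j\<in>{n..<m}. clus S [] j powi (g $ j)) *
      (\<Prod>j<m. x j ^ (if j < n then nat (g $ j) else 0))" .
  moreover have "frozen_laurent_monomial S (\<Prod>j\<in>{n..<m}. clus S [] j powi (g $ j))"
    unfolding frozen_laurent_monomial_def by (rule exI[of _ "\<lambda>j. g $ j"]) (rule refl)
  moreover have "cluster_monomial S t (\<Prod>j<m. x j ^ (if j < n then nat (g $ j) else 0))"
    unfolding cluster_monomial_def
    by (rule exI[of _ "\<lambda>j. if j < n then nat (g $ j) else 0"]) (rule refl)
  ultimately have "\<exists>p w. frozen_laurent_monomial S p \<and> cluster_monomial S t w \<and> u = p * w"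
    by metis
  moreover have "cluster_monomial S t u" if "\<forall>j\<in>{n..<m}. 0 \<le> g $ j"
  proof -
    have "0 \<le> g $ j" if "j < m" for j
      using g[of j] \<open>\<forall>j\<in>{n..<m}. 0 \<le> g $ j\<close> that by (cases "j < n") auto
    then have "(\<Prod>j<m. x j powi (g $ j)) = (\<Prod>j<m. x j ^ nat (g $ j))"
      by (intro prod.cong) (auto simp: power_int_def)
    with u have "u = (\<Prod>j<m. x j ^ nat (g $ j))" by (rule trans)
    then show ?thesis
      unfolding cluster_monomial_def by (rule exI[of _ "\<lambda>j. nat (g $ j)"])
  qed
  ultimately show ?thesis by (simp add: cluster_monomial_mod_frozen_def g_def)
qed

end

context lp_edge
begin

lemma good_pointed: "good S u \<Longrightarrow> pointed S t u" "good S u \<Longrightarrow> pointed S t' u"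
  using vertex T.vertex by (simp_all add: good_def)

lemma good_trop_mutation: "good S u \<Longrightarrow> trop_mutation S k t (deg S t u) (deg S t' u)"
  using adj unfolding good_def tropical_point_def trop_mutation_def by blast

lemma good_invariant:
  assumes "good S u" "q \<in> carrier_vec m" "q' \<in> carrier_vec m" "trop_mutation S k t q q'"
  shows "deg_pairing S t u q = deg_pairing S t' u q'"
proof (rule deg_pairing_invariant[OF assms(2-4)])
  show "u \<in> subtraction_free S t'" using assms(1) T.vertex by (simp add: good_def)
qed (rule good_pointed[OF assms(1)])+

lemma E_deg:
  assumes u: "good S u" and neg: "deg S t u $ k \<le> 0"
  shows "E 1 *\<^sub>v deg S t' u = deg S t u"
proof (rule E_trop_mutation)
  show "deg S t u \<in> carrier_vec m" "deg S t' u \<in> carrier_vec m"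
    using deg_carrier[OF good_pointed(1)[OF u]] T.deg_carrier[OF good_pointed(2)[OF u]] .
  show "trop_mutation S k t (deg S t u) (deg S t' u)" by (rule good_trop_mutation[OF u])
  show "(1::int) = 1 \<or> (1::int) = -1" "1 * deg S t u $ k \<le> 0" using neg by simp_all
qed

text \<open>
  Compare the pairings of \<open>u\<close> with the tropical point through \<open>e k\<close>: for negative \<open>deg S t u $ k\<close>
  the bilinear parts at \<open>t\<close> and \<open>t'\<close> differ by \<open>r * ddiag S k * deg S t u $ k\<close>, which must be made up
  by the F-polynomial at \<open>t\<close>.
\<close>

lemma deg_nonneg:
  assumes u: "good S u" and F: "\<forall>\<nu>\<in>Poly_Mapping.keys (F_poly S t u). Poly_Mapping.lookup \<nu> k = 0"
  shows "0 \<le> deg S t u $ k"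
proof (rule ccontr)
  let ?g = "deg S t u" and ?g' = "deg S t' u"
  assume "\<not> 0 \<le> ?g $ k"
  then have neg: "?g $ k < 0" by simp
  note p = good_pointed[OF u]
  note g = deg_carrier[OF p(1)] and g' = T.deg_carrier[OF p(2)]
  define q' where "q' = vec m (\<lambda>i. if i = k then -1 else pos_part (r * B $$ (i, k)))"
  have q': "q' \<in> carrier_vec m" by (simp add: q'_def)
  have mu: "trop_mutation S k t (e k) q'"
    using k_lt by (auto simp: trop_mutation_def q'_def dual_entry pos_part_def)
  define \<nu> where "\<nu> = r \<cdot>\<^sub>v (unit_vec n k :: int vec)"
  have \<nu>: "\<nu> \<in> carrier_vec n" by (simp add: \<nu>_def)
  have B\<nu>: "B *\<^sub>v \<nu> \<in> carrier_vec m" using \<nu> by (rule mult_mat_vec_carrier[OF B_carrier])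
  have Eq': "E 1 *\<^sub>v q' = e k + B *\<^sub>v \<nu>"
  proof (rule eq_vecI)
    fix i assume "i < dim_vec (e k + B *\<^sub>v \<nu>)"
    then have i: "i < m" by simp
    have "(B *\<^sub>v \<nu>) $ i = r * B $$ (i, k)"
      using i k_lt by (simp add: \<nu>_def)
    then have "(e k + B *\<^sub>v \<nu>) $ i = (if i = k then 1 else 0) + r * B $$ (i, k)"
      using i B\<nu> k_lt by simp
    then show "(E 1 *\<^sub>v q') $ i = (e k + B *\<^sub>v \<nu>) $ i"
      unfolding E_mult[OF q' i] using i k_lt B_diag[OF k_lt(1)]
      by (auto simp: q'_def pos_part_def mult.commute)
  qed simp
  have "?g \<bullet> (L *\<^sub>v (B *\<^sub>v \<nu>)) = - ((L *\<^sub>v ?g) \<bullet> (B *\<^sub>v \<nu>))"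
    using L_skew_scalar[OF g B\<nu>] comm_scalar_prod[OF B\<nu> L_mult_carrier[OF g]] by simp
  also have "\<dots> = - (r * (ddiag S k * ?g $ k))"
    unfolding B_L_scalar[OF g \<nu>] using k_lt D0_mult[OF g k_lt(1)] by (simp add: \<nu>_def D0_def)
  finally have skew: "?g \<bullet> (L *\<^sub>v (B *\<^sub>v \<nu>)) = - (r * (ddiag S k * ?g $ k))" .
  have "?g' \<bullet> (lam S t' *\<^sub>v q') = ?g \<bullet> (L *\<^sub>v (e k + B *\<^sub>v \<nu>))"
    using lam_scalar[of 1, OF _ g' q'] E_deg[OF u less_imp_le[OF neg]] Eq' by simp
  also have "\<dots> = ?g \<bullet> (L *\<^sub>v e k) + ?g \<bullet> (L *\<^sub>v (B *\<^sub>v \<nu>))"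
    using mult_add_distrib_mat_vec[OF L_carrier _ B\<nu>, of "e k"]
      scalar_prod_add_distrib[OF g L_mult_carrier L_mult_carrier[OF B\<nu>], of "e k"] by simp
  finally have "?g' \<bullet> (lam S t' *\<^sub>v q') = ?g \<bullet> (L *\<^sub>v e k) - r * (ddiag S k * ?g $ k)"
    by (simp add: skew)
  moreover have "deg_pairing S t u (e k) = deg_pairing S t' u q'"
    by (rule good_invariant[OF u _ q' mu]) simp
  moreover have "max_deg S (F_poly S t u) (D0 S *\<^sub>v e k) = 0"
    using max_deg_unit_eq_0_iff[OF _ k_lt(1)] F is_F_F_poly[OF p(1)] by blast
  moreover have "0 \<le> max_deg S (F_poly S t' u) (D0 S *\<^sub>v q')"
    using max_deg_nonneg T.is_F_F_poly[OF p(2)] by blast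
  ultimately have "0 \<le> r * (ddiag S k * ?g $ k)"
    by (simp add: deg_pairing_def)
  moreover have "0 < r"
    using pattern k_lt by (simp add: cluster_pattern_def)
  moreover have "ddiag S k * ?g $ k < 0"
    using d_pos[OF k_lt(1)] neg by (simp add: mult_pos_neg)
  ultimately show False using mult_pos_neg[of r "ddiag S k * ?g $ k"] by linarith
qed

text \<open>Here the tropical point through \<open>- e k\<close> is used, for which the bilinear parts agree.\<close>

lemma F_poly_trivial_after_mutation:
  assumes u: "good S u" and neg: "deg S t u $ k \<le> 0"
    and F': "\<And>\<nu> i. \<nu> \<in> Poly_Mapping.keys (F_poly S t' u) \<Longrightarrow> i < n \<Longrightarrow> i \<noteq> k \<Longrightarrow> Poly_Mapping.lookup \<nu> i = 0"
    and \<nu>: "\<nu> \<in> Poly_Mapping.keys (F_poly S t' u)"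
  shows "Poly_Mapping.lookup \<nu> k = 0"
proof -
  let ?g = "deg S t u" and ?g' = "deg S t' u" and ?F = "F_poly S t u" and ?F' = "F_poly S t' u"
  note p = good_pointed[OF u]
  note g = deg_carrier[OF p(1)] and g' = T.deg_carrier[OF p(2)]
  define q where "q = vec m (\<lambda>i. if i = k then -1 else (0::int))"
  define q' where "q' = vec m (\<lambda>i. if i = k then 1 else - pos_part (- (r * B $$ (i, k))))"
  have q: "q \<in> carrier_vec m" "q' \<in> carrier_vec m" by (simp_all add: q_def q'_def)
  have mu: "trop_mutation S k t q q'"
    using k_lt by (auto simp: trop_mutation_def q_def q'_def dual_entry pos_part_def)
  have "E 1 *\<^sub>v q' = q"
    by (rule E_trop_mutation[OF q mu]) (use k_lt in \<open>auto simp: q_def\<close>)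
  then have "?g' \<bullet> (lam S t' *\<^sub>v q') = ?g \<bullet> (L *\<^sub>v q)"
    using lam_scalar[of 1, OF _ g' q(2)] E_deg[OF u neg] by simp
  then have eq: "max_deg S ?F (D0 S *\<^sub>v q) = max_deg S ?F' (D0 S *\<^sub>v q')"
    using good_invariant[OF u q mu] by (simp add: deg_pairing_def)
  have F0: "?F \<noteq> 0" using is_F_F_poly[OF p(1)] by auto
  have "max_deg S ?F (D0 S *\<^sub>v q) \<le> 0"
  proof -
    obtain \<mu> where \<mu>: "(\<Sum>i<n. int (Poly_Mapping.lookup \<mu> i) * (D0 S *\<^sub>v q) $ i) = max_deg S ?F (D0 S *\<^sub>v q)"
      unfolding max_deg_eq_wmax
      using wmax_attained[OF F0, of "\<lambda>\<nu>. \<Sum>i<n. int (Poly_Mapping.lookup \<nu> i) * (D0 S *\<^sub>v q) $ i"] by blast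
    have "(\<Sum>i<n. int (Poly_Mapping.lookup \<mu> i) * (D0 S *\<^sub>v q) $ i) =
        int (Poly_Mapping.lookup \<mu> k) * (ddiag S k * q $ k)"
      by (rule weight_D0[OF q(1) k_lt(1)]) (use n_le_m in \<open>auto simp: q_def\<close>)
    then have "max_deg S ?F (D0 S *\<^sub>v q) = - (int (Poly_Mapping.lookup \<mu> k) * ddiag S k)"
      using k_lt \<mu> by (simp add: q_def)
    moreover have "0 \<le> int (Poly_Mapping.lookup \<mu> k) * ddiag S k"
      using d_pos[OF k_lt(1)] by simp
    ultimately show ?thesis by linarith
  qed
  moreover have "(\<Sum>i<n. int (Poly_Mapping.lookup \<nu> i) * (D0 S *\<^sub>v q') $ i) \<le> max_deg S ?F' (D0 S *\<^sub>v q')"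
    unfolding max_deg_eq_wmax
    by (rule wmax_ge[OF \<nu>, where \<omega> = "\<lambda>\<nu>. \<Sum>i<n. int (Poly_Mapping.lookup \<nu> i) * (D0 S *\<^sub>v q') $ i"])
  moreover have "(\<Sum>i<n. int (Poly_Mapping.lookup \<nu> i) * (D0 S *\<^sub>v q') $ i) =
      int (Poly_Mapping.lookup \<nu> k) * (ddiag S k * q' $ k)"
    by (rule weight_D0[OF q(2) k_lt(1)]) (use F'[OF \<nu>] in auto)
  moreover have "q' $ k = 1" using k_lt by (simp add: q'_def)
  ultimately have "int (Poly_Mapping.lookup \<nu> k) * ddiag S k \<le> 0"
    using eq by simp
  then show ?thesis using d_pos[OF k_lt(1)] by (simp add: mult_le_0_iff)
qed

end

lemma pointed_with_cong:
  assumes clus: "\<And>i. i < n_var S \<Longrightarrow> clus S t i = clus S s i" and mat: "exmat S t = exmat S s"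
  shows "pointed_with S t = pointed_with S s"
proof -
  have "laurent_monomial (n_var S) (clus S t) = laurent_monomial (n_var S) (clus S s)"
    unfolding laurent_monomial_def using clus by (auto intro!: prod.cong)
  moreover have "dom_maximal S t = dom_maximal S s"
    by (intro ext) (simp add: dom_maximal_def dom_le_def mat)
  ultimately show ?thesis by (intro ext) (simp add: pointed_with_def)
qed

lemma cluster_monomial_mod_frozen_cong:
  assumes clus: "\<And>i. i < n_var S \<Longrightarrow> clus S t i = clus S s i" and mat: "exmat S t = exmat S s"
  shows "cluster_monomial_mod_frozen S t u \<longleftrightarrow> cluster_monomial_mod_frozen S s u"
proof -
  have "deg S t u = deg S s u"
    by (simp add: deg_def pointed_with_cong[of S t s, OF assms])
  moreover have "cluster_monomial S t = cluster_monomial S s"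
    by (intro ext) (simp add: cluster_monomial_def clus)
  ultimately show ?thesis by (simp add: cluster_monomial_mod_frozen_def)
qed

theorem corollary4p14:
  fixes S :: "'a::field_char_0 lp_triple" and u :: 'a and t :: "nat list"
  assumes "langlands_poisson_triple S"
    and "u \<in> upper_cluster_algebra S" and "good S u"
    and "t \<in> verts S"
  shows "(\<forall>k<n_mut S. has_F_invariant S (clus S t k) u 0 \<longrightarrow> 0 \<le> deg S t u $ k) \<and>
     ((\<forall>i<n_mut S. has_F_invariant S (clus S t i) u 0) \<longrightarrow> cluster_monomial_mod_frozen S t u) \<and>
     (\<forall>k<n_mut S. \<forall>t'\<in>verts S.
        seed_mutation S k t t' \<and>
        (\<exists>c. has_F_invariant S (clus S t k) u c \<and> c \<noteq> 0) \<and>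
        (\<forall>i<n_mut S. i \<noteq> k \<longrightarrow> has_F_invariant S (clus S t i) u 0) \<longrightarrow>
        cluster_monomial_mod_frozen S t' u)"
proof -
  note triple = assms(1) and u = assms(3)
  interpret lp_seed S t by unfold_locales (use assms in auto)
  have pointed: "pointed S s u" if "s \<in> verts S" for s
    using u that by (simp add: good_def)
  have nonneg: "0 \<le> deg S s u $ k" if s: "s \<in> verts S" and k: "k < n"
    and F: "\<forall>\<nu>\<in>Poly_Mapping.keys (F_poly S s u). Poly_Mapping.lookup \<nu> k = 0" for s k
  proof -
    obtain s' where "tree_adj n k s s'" using tree_neighbour[OF s k] .
    then interpret Z: lp_edge S k s s' by unfold_locales (rule triple)
    show ?thesis by (rule Z.deg_nonneg[OF u F])
  qed
  have 1: "0 \<le> deg S t u $ k" if "k < n" "has_F_invariant S (clus S t k) u 0" for k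
    by (rule nonneg[OF vertex that(1) F_invariant_var_eq_0D[OF that]])
  have 2: "cluster_monomial_mod_frozen S t u" if "\<forall>i<n. has_F_invariant S (clus S t i) u 0"
    by (rule cluster_monomial_mod_frozenI[OF pointed[OF vertex]])
      (use that 1 F_invariant_var_eq_0D in blast)+
  have 3: "cluster_monomial_mod_frozen S t' u"
    if k: "k < n" and mut: "seed_mutation S k t t'" and c: "has_F_invariant S (clus S t k) u c" "c \<noteq> 0"
      and F: "\<And>i. \<lbrakk>i < n; i \<noteq> k\<rbrakk> \<Longrightarrow> has_F_invariant S (clus S t i) u 0" for k t' c
  proof -
    obtain s where adj: "tree_adj n k t s" using tree_neighbour[OF vertex k] .
    interpret X: lp_edge S k t s by unfold_locales (use triple adj in auto)
    interpret Y: lp_edge S k s t by unfold_locales (use triple tree_adj_sym[OF adj] in auto)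
    have mut_s: "seed_mutation S k t s"
      using pattern adj by (simp add: cluster_pattern_def)
    have same: "clus S t i = clus S s i" if "i < n" "i \<noteq> k" for i
      using mut_s that n_le_m unfolding seed_mutation_def by (auto simp: mutated_var_def)
    have F_s: "Poly_Mapping.lookup \<nu> i = 0"
      if "\<nu> \<in> Poly_Mapping.keys (F_poly S s u)" "i < n" "i \<noteq> k" for \<nu> i
      using X.T.F_invariant_var_eq_0D[OF that(2)] F[OF that(2,3)] same[OF that(2,3)] that(1) by simp
    have F_t: "Poly_Mapping.lookup \<nu> i = 0"
      if "\<nu> \<in> Poly_Mapping.keys (F_poly S t u)" "i < n" "i \<noteq> k" for \<nu> i
      using F_invariant_var_eq_0D[OF that(2)] F[OF that(2,3)] that(1) by simp
    have neg: "deg S t u $ k \<le> 0"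
    proof (rule ccontr)
      assume "\<not> deg S t u $ k \<le> 0"
      moreover have "deg S s u $ k = - (deg S t u $ k)"
        using X.good_trop_mutation[OF u] by (simp add: trop_mutation_def)
      ultimately have "deg S s u $ k \<le> 0" by simp
      then have "\<forall>\<nu>\<in>Poly_Mapping.keys (F_poly S t u). Poly_Mapping.lookup \<nu> k = 0"
        using Y.F_poly_trivial_after_mutation[OF u _ F_t] by blast
      moreover have "Poly_Mapping.lookup (F_poly S t u) 0 = 1"
        using is_F_F_poly[OF pointed[OF vertex]] by blast
      ultimately have "c = 0"
        using has_F_invariant_var[OF k c(1)] max_deg_unit_eq_0_iff[OF _ k] by metis
      then show False using c(2) by simp
    qed
    have F_s': "Poly_Mapping.lookup \<nu> i = 0"
      if "\<nu> \<in> Poly_Mapping.keys (F_poly S s u)" "i < n" for \<nu> i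
      using X.F_poly_trivial_after_mutation[OF u neg F_s that(1)] F_s that by (cases "i = k") auto
    have "cluster_monomial_mod_frozen S s u"
      by (rule X.T.cluster_monomial_mod_frozenI)
        (use pointed[OF X.T.vertex] F_s' nonneg[OF X.T.vertex] in blast)+
    moreover have "clus S t' i = clus S s i" if "i < m" for i
      using mut mut_s that unfolding seed_mutation_def by auto
    moreover have "exmat S t' = exmat S s"
      using mut mut_s unfolding seed_mutation_def by auto
    ultimately show ?thesis using cluster_monomial_mod_frozen_cong by blast
  qed
  show ?thesis using 1 2 3 by blast
qed

end
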